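(* For all integers $t\ge 1$ and every admissible ideal $J_{2,t}$ (the ideal $J_{s,t}$ with $s=2$, as defined in the context), one has $\operatorname{ara} J_{2,t}=t+1$; i.e., the variety $V_{2,t}=V(J_{2,t})$ is a set-theoretic complete intersection.
   Context: Let $K$ be an algebraically closed field. For a reduced (radical) proper ideal $I$ of a polynomial ring $R$ in $N$ indeterminates over $K$, let $V(I)\subset K^N$ be the affine variety it defines. The arithmetical rank $\operatorname{ara} I$ is the least $r$ such that there are $F_1,\dots,F_r\in R$ with $I=\sqrt{(F_1,\dots,F_r)}$ (equivalently, $V(I)$ is defined by the equations $F_1=\cdots=F_r=0$). $V(I)$ is called a set-theoretic complete intersection if $\operatorname{ara} I$ equals the codimension of $V(I)$. For integers $s\ge2$, $t\ge1$, consider the two-row matrix $$A_{s,t}=\begin{pmatrix} x_1&x_2&\cdots&x_s& y_0& y_1&\cdots& y_{t-1}\\ x_{s+1}&x_{s+2}&\cdots&x_{2s}& z_1& z_2&\cdots& z_t\end{pmatrix},$$ where the entries $x_1,\dots,x_{2s},y_0,\dots,y_{t-1},z_1,\dots,z_t$ are indeterminates over $K$, assumed pairwise distinct with the following possible exceptions: one may have $x_{2s}=y_0$, or $z_i=y_j$ for some indices with $1\le i\le j\le t-1$, provided no entry appears more than twice in $A_{s,t}$. Let $R=K[x_1,\dots,x_{2s},y_0,\dots,y_{t-1},z_1,\dots,z_t]$ be the polynomial ring in the distinct entries. The ideal $J_{s,t}\subset R$ is generated by the union of: (I) the $2\times2$ minors of the submatrix formed by the first $s$ columns of $A_{s,t}$;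 (II) the products $x_iz_j$ with $1\le i\le s$, $1\le j\le t$; (III) the products $y_iz_j$ with $0\le i\le j-2\le t-2$. Thus $J_{s,t}$ denotes any ideal of the class obtained by varying the allowed identifications among the indeterminates, and statements about $J_{s,t}$ hold for every such choice. Put $V_{s,t}=V(J_{s,t})$. *)

theory Defs
  imports
    "HOL-Computational_Algebra.Computational_Algebra"
    "HOL-Library.Poly_Mapping"
    "HOL-Library.Extended_Nat"
begin

section \<open>Polynomials, ideals and affine varieties\<close>

text \<open>The polynomial ring over the field \<open>'k\<close> in the indeterminates \<open>'v\<close>: finitely supported
  maps from monomials (finitely supported exponent vectors) to coefficients, with the
  convolution product.  The set of indeterminates is the whole type \<open>'v\<close>; affine space is the
  type \<open>'v \<Rightarrow> 'k\<close>.\<close>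

type_synonym ('v, 'k) mpol = "('v \<Rightarrow>\<^sub>0 nat) \<Rightarrow>\<^sub>0 'k"

definition var :: "'v \<Rightarrow> ('v, 'k::comm_ring_1) mpol" where
  "var v = Poly_Mapping.single (Poly_Mapping.single v 1) 1"

definition eval_mpol :: "('v \<Rightarrow> 'k::comm_ring_1) \<Rightarrow> ('v, 'k) mpol \<Rightarrow> 'k" where
  "eval_mpol p f = (\<Sum>m\<in>Poly_Mapping.keys f. Poly_Mapping.lookup f m *
     (\<Prod>v\<in>Poly_Mapping.keys m. p v ^ Poly_Mapping.lookup m v))"

text \<open>An ideal is a submodule of the ring regarded as a module over itself.\<close>

lemma module_times: "module ((*) :: 'a \<Rightarrow> 'a \<Rightarrow> 'a::comm_ring_1)"
  by unfold_locales (simp_all add: algebra_simps)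

definition ideal_gen :: "'a::comm_ring_1 set \<Rightarrow> 'a set" where
  "ideal_gen S = module.span (*) S"

definition radical :: "'a::comm_ring_1 set \<Rightarrow> 'a set" where
  "radical I = {f. \<exists>n. f ^ n \<in> I}"

definition variety :: "('v, 'k::field) mpol set \<Rightarrow> ('v \<Rightarrow> 'k) set" where
  "variety S = {p. \<forall>f\<in>S. eval_mpol p f = 0}"

definition zariski_closed :: "('v \<Rightarrow> 'k::field) set \<Rightarrow> bool" where
  "zariski_closed C \<longleftrightarrow> (\<exists>S. C = variety S)"

definition irreducible_closed :: "('v \<Rightarrow> 'k::field) set \<Rightarrow> bool" where
  "irreducible_closed C \<longleftrightarrow> zariski_closed C \<and> C \<noteq> {} \<and>
     (\<forall>A B. zariski_closed A \<and> zariski_closed B \<and> C = A \<union> B \<longrightarrow> A = C \<or> B = C)"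

text \<open>The dimension of a nonempty closed set \<open>V\<close>, as the supremum of the lengths \<open>n\<close> of chains
  \<open>C 0 \<subset> \<dots> \<subset> C n\<close> of irreducible closed subsets of \<open>V\<close>.\<close>

definition variety_dim :: "('v \<Rightarrow> 'k::field) set \<Rightarrow> enat" where
  "variety_dim V = (SUP n \<in> {n. \<exists>C. (\<forall>i\<le>n. irreducible_closed (C i) \<and> C i \<subseteq> V) \<and>
     (\<forall>i<n. C i \<subset> C (Suc i))}. enat n)"

definition variety_codim :: "('v \<Rightarrow> 'k::field) set \<Rightarrow> enat" where
  "variety_codim V = enat (card (UNIV :: 'v set)) - variety_dim V"

text \<open>The arithmetical rank is \<open>\<infinity>\<close> if there are no such \<open>F\<close>, in particular if \<open>I\<close> is
  not a radical ideal.\<close>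

definition ara :: "'a::comm_ring_1 set \<Rightarrow> enat" where
  "ara I = (INF r \<in> {r. \<exists>F. I = radical (ideal_gen (F ` {1..r}))}. enat r)"

text \<open>A property of the variety of \<open>I\<close>, expressed in terms of the reduced ideal \<open>I\<close>.\<close>

definition set_theoretic_complete_intersection :: "('v, 'k::field) mpol set \<Rightarrow> bool" where
  "set_theoretic_complete_intersection I \<longleftrightarrow> ara I = variety_codim (variety I)"


section \<open>The two-row matrices and their ideals\<close>

text \<open>The symbols \<open>x\<^sub>i\<close>, \<open>y\<^sub>i\<close>, \<open>z\<^sub>i\<close>, before any identification is made.\<close>

datatype entry = Ent_x nat | Ent_y nat | Ent_z nat

definition entries :: "nat \<Rightarrow> nat \<Rightarrow> entry set" where
  "entries s t = Ent_x ` {1..2*s} \<union> Ent_y ` {0..<t} \<union> Ent_z ` {1..t}"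

text \<open>The entry of \<open>A\<^sub>s\<^sub>,\<^sub>t\<close> in row \<open>r \<in> {1, 2}\<close> and column \<open>c \<in> {1..s+t}\<close>.\<close>

definition mat_entry :: "nat \<Rightarrow> nat \<Rightarrow> nat \<Rightarrow> entry" where
  "mat_entry s r c =
     (if r = 1 then if c \<le> s then Ent_x c else Ent_y (c - s - 1)
      else if c \<le> s then Ent_x (s + c) else Ent_z (c - s))"

lemma bij_betw_mat_entry:
  "bij_betw (\<lambda>(r, c). mat_entry s r c) ({1, 2} \<times> {1..s + t}) (entries s t)"
proof -
  have "inj_on (\<lambda>(r, c). mat_entry s r c) ({1, 2} \<times> {1..s + t})"
    by (auto simp: inj_on_def mat_entry_def split: if_splits)
  moreover have "e \<in> (\<lambda>(r, c). mat_entry s r c) ` ({1, 2} \<times> {1..s + t})"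
    if "e \<in> entries s t" for e
  proof (cases e)
    case (Ent_x i)
    with that have "i \<in> {1..2*s}" by (auto simp: entries_def)
    then show ?thesis
      using Ent_x by (intro image_eqI[of _ _ "if i \<le> s then (1, i) else (2, i - s)"])
        (auto simp: mat_entry_def)
  next
    case (Ent_y i)
    with that show ?thesis
      by (intro image_eqI[of _ _ "(1, s + i + 1)"]) (auto simp: mat_entry_def entries_def)
  next
    case (Ent_z i)
    with that show ?thesis
      by (intro image_eqI[of _ _ "(2, s + i)"]) (auto simp: mat_entry_def entries_def)
  qed
  moreover have "mat_entry s r c \<in> entries s t" if "r \<in> {1, 2}" "c \<in> {1..s + t}" for r c
    using that by (force simp: mat_entry_def entries_def image_iff)
  ultimately show ?thesis
    unfolding bij_betw_def by fast
qed

definition may_coincide :: "nat \<Rightarrow> nat \<Rightarrow> entry \<Rightarrow> entry \<Rightarrow> bool" where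
  "may_coincide s t a b \<longleftrightarrow> (a = Ent_x (2*s) \<and> b = Ent_y 0) \<or>
     (\<exists>i j. 1 \<le> i \<and> i \<le> j \<and> j \<le> t - 1 \<and> a = Ent_z i \<and> b = Ent_y j)"

text \<open>A choice of identifications is a map \<open>e\<close> sending each symbol to an indeterminate.  As
  the polynomial ring is the one in the distinct entries, \<open>e\<close> has to hit every
  indeterminate.\<close>

definition admissible :: "nat \<Rightarrow> nat \<Rightarrow> (entry \<Rightarrow> 'v) \<Rightarrow> bool" where
  "admissible s t e \<longleftrightarrow>
     e ` entries s t = UNIV \<and>
     (\<forall>a\<in>entries s t. \<forall>b\<in>entries s t. e a = e b \<longrightarrow>
        a = b \<or> may_coincide s t a b \<or> may_coincide s t b a) \<and>
     (\<forall>v. card {(r, c). r \<in> {1, 2} \<and> c \<in> {1..s + t} \<and> e (mat_entry s r c) = v} \<le> 2)"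

definition minor_gens :: "(entry \<Rightarrow> 'v) \<Rightarrow> nat \<Rightarrow> ('v, 'k::field) mpol set" where
  "minor_gens e s = {var (e (mat_entry s 1 i)) * var (e (mat_entry s 2 j)) -
     var (e (mat_entry s 1 j)) * var (e (mat_entry s 2 i)) | i j. 1 \<le> i \<and> i < j \<and> j \<le> s}"

definition xz_gens :: "(entry \<Rightarrow> 'v) \<Rightarrow> nat \<Rightarrow> nat \<Rightarrow> ('v, 'k::field) mpol set" where
  "xz_gens e s t = {var (e (Ent_x i)) * var (e (Ent_z j)) | i j.
     1 \<le> i \<and> i \<le> s \<and> 1 \<le> j \<and> j \<le> t}"

definition yz_gens :: "(entry \<Rightarrow> 'v) \<Rightarrow> nat \<Rightarrow> ('v, 'k::field) mpol set" where
  "yz_gens e t = {var (e (Ent_y i)) * var (e (Ent_z j)) | i j. i + 2 \<le> j \<and> j \<le> t}"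

definition J_ideal :: "(entry \<Rightarrow> 'v) \<Rightarrow> nat \<Rightarrow> nat \<Rightarrow> ('v, 'k::field) mpol set" where
  "J_ideal e s t = ideal_gen (minor_gens e s \<union> xz_gens e s t \<union> yz_gens e t)"

end

theory Submission
  imports Defs
begin

text \<open>Put \<open>u\<^sub>0 = x\<^sub>1\<close>, \<open>u\<^sub>1 = x\<^sub>2\<close>, \<open>u\<^sub>i = y\<^bsub>i-2\<^esub>\<close> for \<open>i \<ge> 2\<close> and \<open>\<Delta> = x\<^sub>1 x\<^sub>4 - x\<^sub>2 x\<^sub>3\<close>.  Then \<open>J = J\<^bsub>2,t\<^esub>\<close> is generated
by \<open>\<Delta>\<close> and the products \<open>u\<^sub>i z\<^sub>j\<close> with \<open>i \<le> j\<close>, \<open>1 \<le> j \<le> t\<close>.  Every admissible identification leaves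
\<open>u\<^sub>0, \<dots>, u\<^sub>t\<close> different from each other, likewise \<open>z\<^sub>1, \<dots>, z\<^sub>t\<close>, and \<open>u\<^sub>i \<noteq> z\<^sub>j\<close> for \<open>i \<le> j\<close>; it also
keeps \<open>x\<^sub>1, \<dots>, x\<^sub>4\<close> apart from each other and from the \<open>z\<^sub>j\<close>.  The proof is the same for all of them.  Let \<open>N\<close> be the number of
indeterminates.

\<^emph>\<open>Upper bound.\<close>  The \<open>t + 1\<close> diagonal sums \<open>S\<^sub>c = \<Sum>\<^sub>i u\<^sub>i z\<^bsub>i+c\<^esub>\<close>, \<open>0 \<le> c \<le> t\<close>, generate the products up to
radical by the lemma of Schmitt and Vogel.  They satisfy a linear relation whose coefficients generate,
up to radical, an ideal containing \<open>(u\<^sub>0, u\<^sub>1)\<close> and therefore \<open>\<Delta>\<close>; subtracting suitable multiples of \<open>\<Delta>\<close>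
from the \<open>S\<^sub>c\<close> forces a power of \<open>\<Delta>\<close> into the ideal that they generate without a further equation
(\<open>staircase_radical_generators\<close>).  That their radical is \<open>J\<close> needs \<open>J\<close> to be radical (\<open>radical_J\<close>),
which follows from the linear independence of the standard monomials on the variety.

\<^emph>\<open>Lower bound and codimension.\<close>  Both come from counting standard monomials.  The indeterminates with
large exponents in a standard monomial form an independent set of the graph with edges \<open>x\<^sub>2 x\<^sub>3\<close> and
\<open>u\<^sub>i z\<^sub>j\<close>, and such a set misses at least \<open>t + 1\<close> indeterminates (\<open>independent_misses\<close>).  So the polynomials
of degree at most \<open>D\<close> have dimension \<open>O(D\<^sup>d)\<close> with \<open>d = N - (t + 1)\<close> modulo \<open>J\<close>, and also modulo any
ideal that contains a power of each generator of \<open>J\<close> (\<open>growth\<close>).  This bounds the length of chains of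
irreducible closed sets by \<open>d\<close>, because a longer chain would give too many independent functions
(\<open>chain_length_le_growth\<close>), and it bounds the number of equations from below by \<open>N - d\<close>, because powers of
fewer equations cannot account for all monomials (\<open>number_of_equations_growth\<close>).  A coordinate subspace
of dimension \<open>d\<close> in the variety shows that the bound \<open>d\<close> for the dimension is attained (\<open>dim_ge\<close>).\<close>

section \<open>Linear relations modulo a subspace\<close>

text \<open>If a vector space is spanned modulo \<open>W\<close> by fewer elements than there are members in a family, the
family is dependent modulo \<open>W\<close>.  Eliminating one spanning vector \<open>b\<close> at a time costs at most one
member of the family: the pivot \<open>a0\<close>.  Working modulo \<open>W\<close> in place avoids quotient spaces.\<close>

lemma (in vector_space) nontrivial_relation_modulo_subspace:
  assumes "finite B" "subspace W" "finite A" "card B < card A"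
    and "\<And>a. a \<in> A \<Longrightarrow> f a \<in> span (B \<union> W)"
  shows "\<exists>c. (\<exists>a\<in>A. c a \<noteq> 0) \<and> (\<Sum>a\<in>A. c a *s f a) \<in> W"
  using assms(1,3-5)
proof (induction B arbitrary: A f rule: finite_induct)
  case empty
  then obtain a where "a \<in> A" by (metis card_gt_0_iff card.empty ex_in_conv)
  have "span W = W" using assms(2) by simp
  then show ?case
    using \<open>a \<in> A\<close> empty
    by (intro exI[of _ "\<lambda>_. 1"]) (fastforce intro!: subspace_sum[OF assms(2)])
next
  case (insert b B)
  have "\<exists>k. f a - k *s b \<in> span (B \<union> W)" if "a \<in> A" for a
    using span_breakdown_eq[of "f a" b "B \<union> W"] insert.prems(3)[OF that] by simp
  then obtain k where k: "\<And>a. a \<in> A \<Longrightarrow> f a - k a *s b \<in> span (B \<union> W)"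
    by metis
  show ?case
  proof (cases "\<forall>a\<in>A. k a = 0")
    case True
    then have "f a \<in> span (B \<union> W)" if "a \<in> A" for a
      using k[OF that] that by simp
    then show ?thesis
      using insert by (intro insert.IH) auto
  next
    case False
    then obtain a0 where a0: "a0 \<in> A" "k a0 \<noteq> 0" by blast
    define g where "g = (\<lambda>a. f a - (k a / k a0) *s f a0)"
    have "g a \<in> span (B \<union> W)" if "a \<in> A - {a0}" for a
    proof -
      have "g a = (f a - k a *s b) - (k a / k a0) *s (f a0 - k a0 *s b)"
        using a0(2) by (simp add: g_def scale_right_diff_distrib)
      then show ?thesis
        using that k a0(1) by (auto intro: span_diff span_scale)
    qed
    moreover have "card B < card (A - {a0})"
      using insert a0(1) by simp
    ultimately obtain c where c: "\<exists>a\<in>A - {a0}. c a \<noteq> 0" "(\<Sum>a\<in>A - {a0}. c a *s g a) \<in> W"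
      using insert.IH[of "A - {a0}" g] insert.prems(1) by blast
    define c' where "c' = c(a0 := - (\<Sum>a\<in>A - {a0}. c a * (k a / k a0)))"
    have "(\<Sum>a\<in>A. c' a *s f a) = c' a0 *s f a0 + (\<Sum>a\<in>A - {a0}. c' a *s f a)"
      using insert.prems(1) a0(1) by (rule sum.remove)
    also have "(\<Sum>a\<in>A - {a0}. c' a *s f a) = (\<Sum>a\<in>A - {a0}. c a *s f a)"
      by (rule sum.cong) (auto simp: c'_def)
    also have "c' a0 *s f a0 + \<dots> = (\<Sum>a\<in>A - {a0}. c a *s g a)"
      by (simp add: c'_def g_def scale_right_diff_distrib sum_subtractf scale_sum_left)
    finally have "(\<Sum>a\<in>A. c' a *s f a) \<in> W"
      using c(2) by simp
    moreover have "\<exists>a\<in>A. c' a \<noteq> 0"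
      using c(1) by (auto simp: c'_def)
    ultimately show ?thesis by blast
  qed
qed

section \<open>Radicals and equations for a staircase of products\<close>

interpretation ideal: module "(*) :: 'a \<Rightarrow> 'a \<Rightarrow> 'a::comm_ring_1"
  by (rule module_times)

(* As a rewrite rule this fact is a * (b * x) = (a * b) * x, which loops with associativity. *)
declare ideal.scale_scale [simp del]

lemma ideal_mult_right: "ideal.subspace I \<Longrightarrow> x \<in> I \<Longrightarrow> x * r \<in> I"
  using ideal.subspace_scale[of I x r] by (simp add: mult.commute)

lemma ideal_power_ge:
  assumes "ideal.subspace I" "x ^ m \<in> I" "m \<le> n"
  shows "x ^ n \<in> I"
  using ideal_mult_right[OF assms(1,2), of "x ^ (n - m)"] assms(3)
  by (simp flip: power_add)

text \<open>In the binomial expansion of \<open>(x + y) ^ (m + n)\<close> every term has a factor \<open>x ^ m\<close> or \<open>y ^ n\<close>.\<close>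

lemma subspace_radical:
  fixes I :: "'a::comm_ring_1 set"
  assumes I: "ideal.subspace I"
  shows "ideal.subspace (radical I)"
proof (rule ideal.subspaceI)
  show "0 \<in> radical I"
    using ideal.subspace_0[OF I] by (auto simp: radical_def intro!: exI[of _ 1])
next
  fix x y assume "x \<in> radical I" "y \<in> radical I"
  then obtain m n where mn: "x ^ m \<in> I" "y ^ n \<in> I"
    by (auto simp: radical_def)
  have "(x + y) ^ (m + n) = (\<Sum>k\<le>m + n. of_nat ((m + n) choose k) * x ^ k * y ^ (m + n - k))"
    by (rule binomial_ring)
  also have "\<dots> \<in> I"
  proof (rule ideal.subspace_sum[OF I])
    fix k assume "k \<in> {..m + n}"
    show "of_nat ((m + n) choose k) * x ^ k * y ^ (m + n - k) \<in> I"
    proof (cases "m \<le> k")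
      case True
      from ideal_mult_right[OF I ideal_power_ge[OF I mn(1) True],
          of "of_nat ((m + n) choose k) * y ^ (m + n - k)"]
      show ?thesis by (simp add: ac_simps)
    next
      case False
      then have "n \<le> m + n - k" by simp
      from ideal_mult_right[OF I ideal_power_ge[OF I mn(2) this],
          of "of_nat ((m + n) choose k) * x ^ k"]
      show ?thesis by (simp add: ac_simps)
    qed
  qed
  finally show "x + y \<in> radical I"
    by (auto simp: radical_def)
next
  fix c x assume "x \<in> radical I"
  then obtain n where "x ^ n \<in> I" by (auto simp: radical_def)
  then have "(c * x) ^ n \<in> I"
    using ideal.subspace_scale[OF I, of "x ^ n" "c ^ n"] by (simp add: power_mult_distrib)
  then show "c * x \<in> radical I" by (auto simp: radical_def)
qed

lemma radical_superset: "I \<subseteq> radical I"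
  by (auto simp: radical_def intro!: exI[of _ 1])

lemma radical_power_imp: "x ^ n \<in> radical I \<Longrightarrow> x \<in> radical I"
  by (auto simp: radical_def simp flip: power_mult)

text \<open>\<open>inverse_coeff u n\<close> is \<open>u\<^sub>0\<^bsup>n+1\<^esup>\<close> times the coefficient of \<open>T\<^sup>n\<close> in the inverse of the power
series \<open>u\<^sub>0 + u\<^sub>1 T + u\<^sub>2 T\<^sup>2 + \<dots>\<close>; this multiple is a polynomial in the \<open>u\<^sub>i\<close>.\<close>

fun inverse_coeff :: "(nat \<Rightarrow> 'a::comm_ring_1) \<Rightarrow> nat \<Rightarrow> 'a" where
  "inverse_coeff u 0 = 1"
| "inverse_coeff u (Suc n) = - (\<Sum>i\<le>n. u (Suc i) * u 0 ^ i * inverse_coeff u (n - i))"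

lemma inverse_coeff_convolution:
  assumes "1 \<le> j"
  shows "(\<Sum>c\<le>j. u 0 ^ (j - c) * inverse_coeff u c * u (j - c)) = 0"
proof -
  obtain n where j: "j = Suc n" using assms by (cases j) auto
  have "(\<Sum>c\<le>j. u 0 ^ (j - c) * inverse_coeff u c * u (j - c))
      = (\<Sum>i\<le>j. u 0 ^ i * inverse_coeff u (j - i) * u i)"
    by (rule sum.reindex_bij_witness[of _ "\<lambda>c. j - c" "\<lambda>c. j - c"]) auto
  also have "\<dots> = inverse_coeff u (Suc n) * u 0
      + (\<Sum>i\<le>n. u 0 ^ Suc i * inverse_coeff u (n - i) * u (Suc i))"
    unfolding j by (subst sum.atMost_Suc_shift) simp
  also have "(\<Sum>i\<le>n. u 0 ^ Suc i * inverse_coeff u (n - i) * u (Suc i))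
      = u 0 * (\<Sum>i\<le>n. u (Suc i) * u 0 ^ i * inverse_coeff u (n - i))"
    unfolding sum_distrib_left power_Suc by (simp only: mult_ac)
  also have "inverse_coeff u (Suc n) * u 0 + \<dots> = 0"
    unfolding inverse_coeff.simps by (simp only: mult.commute[of _ "u 0"]) simp
  finally show ?thesis .
qed

text \<open>Modulo \<open>u\<^sub>0\<close> only the summand with \<open>i = 0\<close> survives in the recursion, so the values become powers.\<close>

lemma inverse_coeff_mod: "u 0 dvd inverse_coeff u n - (- u 1) ^ n"
proof (induction n)
  case (Suc n)
  define R where "R = (\<Sum>i\<in>{..n} - {0}. u (Suc i) * u 0 ^ i * inverse_coeff u (n - i))"
  have "(\<Sum>i\<le>n. u (Suc i) * u 0 ^ i * inverse_coeff u (n - i)) = u 1 * inverse_coeff u n + R"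
    unfolding R_def by (subst sum.remove[of _ 0]) auto
  then have "inverse_coeff u (Suc n) - (- u 1) ^ Suc n
      = - u 1 * (inverse_coeff u n - (- u 1) ^ n) - R"
    unfolding inverse_coeff.simps power_Suc by (simp only: right_diff_distrib) simp
  moreover have "u 0 dvd R"
    unfolding R_def by (rule dvd_sum) (auto intro!: dvd_mult2 dvd_mult dvd_power)
  ultimately show ?case
    using Suc by (metis dvd_diff dvd_mult)
qed simp

text \<open>The inner sums on the left are coefficients of the product of \<open>\<Sum> u\<^sub>i T\<^sup>i\<close> and \<open>\<Sum> z\<^sub>j T\<^bsup>-j\<^esup>\<close>; collecting
by \<open>z\<^sub>j\<close> shows that a weighted sum of them vanishes as soon as the convolutions of \<open>w\<close> and \<open>u\<close> do.\<close>

lemma sum_diagonals: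
  fixes u z w :: "nat \<Rightarrow> 'a::comm_ring_1"
  shows "(\<Sum>c\<le>t. w c * (\<Sum>i\<le>t - c. u i * z (i + c))) = (\<Sum>j\<le>t. (\<Sum>c\<le>j. w c * u (j - c)) * z j)"
proof -
  have "(\<Sum>c\<le>t. w c * (\<Sum>i\<le>t - c. u i * z (i + c)))
      = (\<Sum>(c, i)\<in>Sigma {..t} (\<lambda>c. {..t - c}). w c * (u i * z (i + c)))"
    by (simp add: sum_distrib_left sum.Sigma)
  also have "Sigma {..t} (\<lambda>c. {..t - c}) = {(c, i). c + i \<le> t}"
    by auto
  also have "(\<Sum>(c, i)\<in>{(c, i). c + i \<le> t}. w c * (u i * z (i + c)))
      = (\<Sum>j\<le>t. \<Sum>c\<le>j. w c * (u (j - c) * z ((j - c) + c)))"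
    by (rule sum.triangle_reindex_eq)
  also have "\<dots> = (\<Sum>j\<le>t. (\<Sum>c\<le>j. w c * u (j - c)) * z j)"
    by (simp add: sum_distrib_right mult.assoc)
  finally show ?thesis .
qed

text \<open>The argument of Schmitt and Vogel: for two different products \<open>u\<^sub>i z\<^sub>j\<close> and \<open>u\<^sub>l z\<^bsub>l+c\<^esub>\<close> on the diagonal
\<open>j - i = c\<close>, the product of the two is divisible by a product on a longer diagonal, that is, one with
a larger difference of indices.  By induction those lie in the radical already, so multiplying the sum
over the diagonal by \<open>u\<^sub>i z\<^sub>j\<close> isolates \<open>(u\<^sub>i z\<^sub>j)\<^sup>2\<close>.\<close>

lemma diagonal_sums_radical:
  fixes u z :: "nat \<Rightarrow> 'a::comm_ring_1"
  assumes I: "ideal.subspace I"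
    and S: "\<And>c. c \<le> t \<Longrightarrow> (\<Sum>i\<le>t - c. u i * z (i + c)) \<in> radical I"
    and "i \<le> j" "j \<le> t"
  shows "u i * z j \<in> radical I"
  using assms(3,4)
proof (induction "t - (j - i)" arbitrary: i j rule: less_induct)
  case less
  note R = subspace_radical[OF I]
  define c where "c = j - i"
  have c: "c \<le> t" "j = i + c" "i \<in> {..t - c}"
    using less.prems by (auto simp: c_def)
  have other: "u i * z j * (u l * z (l + c)) \<in> radical I" if "l \<in> {..t - c} - {i}" for l
  proof (cases "l < i")
    case True
    then have "u l * z j \<in> radical I"
      using less.prems by (intro less.hyps) auto
    from ideal.subspace_scale[OF R this, of "u i * z (l + c)"]
    show ?thesis by (simp add: ac_simps)
  next
    case False
    then have "u i * z (l + c) \<in> radical I"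
      using less.prems that by (intro less.hyps) (auto simp: c_def)
    from ideal.subspace_scale[OF R this, of "u l * z j"]
    show ?thesis by (simp add: ac_simps)
  qed
  have "u i * z j * (\<Sum>l\<le>t - c. u l * z (l + c)) \<in> radical I"
    using S[OF c(1)] by (rule ideal.subspace_scale[OF R])
  moreover have "u i * z j * (\<Sum>l\<le>t - c. u l * z (l + c))
      = (u i * z j) ^ 2 + (\<Sum>l\<in>{..t - c} - {i}. u i * z j * (u l * z (l + c)))"
  proof -
    have "(\<Sum>l\<le>t - c. u l * z (l + c)) = u i * z j + (\<Sum>l\<in>{..t - c} - {i}. u l * z (l + c))"
      unfolding c(2) by (rule sum.remove) (use c in auto)
    then show ?thesis by (simp only: distrib_left sum_distrib_left power2_eq_square)
  qed
  ultimately have "(u i * z j) ^ 2 + (\<Sum>l\<in>{..t - c} - {i}. u i * z j * (u l * z (l + c))) \<in> radical I"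
    by simp
  moreover have "(\<Sum>l\<in>{..t - c} - {i}. u i * z j * (u l * z (l + c))) \<in> radical I"
    by (rule ideal.subspace_sum[OF R other])
  ultimately have "(u i * z j) ^ 2 + (\<Sum>l\<in>{..t - c} - {i}. u i * z j * (u l * z (l + c)))
      - (\<Sum>l\<in>{..t - c} - {i}. u i * z j * (u l * z (l + c))) \<in> radical I"
    by (rule ideal.subspace_diff[OF R])
  then
  have "(u i * z j) ^ 2 \<in> radical I" by (simp only: add_diff_cancel_right')
  then show ?case by (rule radical_power_imp)
qed

text \<open>There are \<open>t + 1\<close> diagonal sums \<open>S\<^sub>c = \<Sum> u\<^sub>i z\<^bsub>i+c\<^esub>\<close>, and they generate the products \<open>u\<^sub>i z\<^sub>j\<close> up to
radical.  The further element \<open>d\<close> costs no further equation because the \<open>S\<^sub>c\<close> satisfy a linear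
relation \<open>\<Sum> w\<^sub>c S\<^sub>c = 0\<close>, with \<open>w\<^sub>c\<close> the coefficients of the inverse series of \<open>\<Sum> u\<^sub>i T\<^sup>i\<close> cleared of
denominators.  Up to radical \<open>w\<^sub>0\<close> and \<open>w\<^sub>t\<close> generate an ideal that contains \<open>u\<^sub>0\<close> and \<open>u\<^sub>1\<close>, hence \<open>d\<close>; so
\<open>d ^ p = \<Sum> w\<^sub>c a\<^sub>c\<close> for suitable \<open>a\<^sub>c\<close>.  Replacing \<open>S\<^sub>c\<close> by \<open>S\<^sub>c - a\<^sub>c d\<close> turns the relation into
\<open>\<Sum> w\<^sub>c (S\<^sub>c - a\<^sub>c d) = - d\<^bsup>p+1\<^esup>\<close>, which puts \<open>d\<close>, and then every \<open>S\<^sub>c\<close>, into the radical.  The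
condition \<open>z 0 = 0\<close> removes the product \<open>u\<^sub>0 z\<^sub>0\<close>, for which the relation would fail.\<close>

lemma staircase_radical_generators:
  fixes u z :: "nat \<Rightarrow> 'a::comm_ring_1"
  assumes "1 \<le> t" and z0: "z 0 = 0" and d: "d = r * u 0 + s * u 1"
  defines "G \<equiv> insert d {u i * z j | i j. i \<le> j \<and> j \<le> t}"
  obtains F where "F ` {1..t + 1} \<subseteq> ideal_gen G" "G \<subseteq> radical (ideal_gen (F ` {1..t + 1}))"
proof -
  define w where "w c = u 0 ^ (t - c) * inverse_coeff u c" for c
  let ?W = "ideal.span {w 0, w t}"
  have R: "ideal.subspace (radical ?W)"
    by (intro subspace_radical) simp
  have u0: "u 0 \<in> radical ?W"
  proof -
    have "u 0 ^ t \<in> ?W" using ideal.span_base[of "w 0" "{w 0, w t}"] by (simp add: w_def)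
    then show ?thesis by (auto simp: radical_def)
  qed
  have u1: "u 1 \<in> radical ?W"
  proof -
    obtain q where q: "inverse_coeff u t - (- u 1) ^ t = u 0 * q"
      using inverse_coeff_mod[of u t] by (auto simp: dvd_def)
    have "w t \<in> radical ?W"
      using radical_superset ideal.span_base[of "w t" "{w 0, w t}"] by blast
    then have "(- u 1) ^ t \<in> radical ?W"
      using ideal.subspace_diff[OF R, of "w t" "u 0 * q"] ideal_mult_right[OF R u0, of q] q
      by (simp add: w_def algebra_simps)
    then show ?thesis
      using ideal.subspace_neg[OF R radical_power_imp] by fastforce
  qed
  have "d \<in> radical ?W"
    unfolding d by (intro ideal.subspace_add[OF R] ideal.subspace_scale[OF R] u0 u1)
  then obtain p where "d ^ p \<in> ?W" by (auto simp: radical_def)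
  then obtain a0 where "d ^ p - a0 * w 0 \<in> ideal.span {w t}"
    by (auto simp: ideal.span_insert)
  then obtain a1 where a1: "d ^ p = a0 * w 0 + a1 * w t"
    by (auto simp: ideal.span_singleton algebra_simps)
  define a where "a c = (if c = 0 then a0 else if c = t then a1 else 0)" for c
  have a: "(\<Sum>c\<le>t. w c * a c) = d ^ p"
  proof -
    have "(\<Sum>c\<le>t. w c * a c) = (\<Sum>c\<in>{0, t}. w c * a c)"
      by (rule sum.mono_neutral_right) (auto simp: a_def)
    then show ?thesis using \<open>1 \<le> t\<close> a1 by (simp add: a_def ac_simps)
  qed
  define S where "S c = (\<Sum>i\<le>t - c. u i * z (i + c))" for c
  have syz: "(\<Sum>c\<le>t. w c * S c) = 0"
  proof -
    have "(\<Sum>c\<le>j. w c * u (j - c)) * z j = 0" if "j \<le> t" for j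
    proof (cases "j = 0")
      case False
      have "(\<Sum>c\<le>j. w c * u (j - c))
          = (\<Sum>c\<le>j. u 0 ^ (t - j) * (u 0 ^ (j - c) * inverse_coeff u c * u (j - c)))"
      proof (rule sum.cong)
        fix c assume "c \<in> {..j}"
        then have "t - c = (t - j) + (j - c)" using that by auto
        then show "w c * u (j - c)
            = u 0 ^ (t - j) * (u 0 ^ (j - c) * inverse_coeff u c * u (j - c))"
          by (simp add: w_def power_add mult.assoc)
      qed simp
      also have "\<dots> = 0"
        using inverse_coeff_convolution[of j u] False by (simp flip: sum_distrib_left)
      finally show ?thesis by simp
    qed (simp add: z0)
    then show ?thesis
      unfolding S_def sum_diagonals by simp
  qed
  \<comment> \<open>The equations are numbered from 1, the diagonals from 0.\<close>
  define F where "F l = S (l - 1) - a (l - 1) * d" for l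
  let ?I = "ideal.span (F ` {1..t + 1})"
  have I: "ideal.subspace (radical ?I)" by (intro subspace_radical) simp
  have F: "S c - a c * d \<in> ?I" if "c \<le> t" for c
  proof -
    have "S c - a c * d = F (Suc c)" by (simp add: F_def)
    then show ?thesis using that by (auto intro!: ideal.span_base)
  qed
  have dI: "d \<in> radical ?I"
  proof -
    have "(\<Sum>c\<le>t. w c * (S c - a c * d)) \<in> ?I"
      using F by (intro ideal.span_sum ideal.span_scale) auto
    moreover have "(\<Sum>c\<le>t. w c * (S c - a c * d))
        = (\<Sum>c\<le>t. w c * S c) - (\<Sum>c\<le>t. w c * a c) * d"
      by (simp add: right_diff_distrib sum_subtractf sum_distrib_right mult.assoc)
    then have "(\<Sum>c\<le>t. w c * (S c - a c * d)) = - (d ^ Suc p)"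
      using syz a by (simp add: mult.commute)
    ultimately have "d ^ Suc p \<in> ?I"
      using ideal.span_neg by fastforce
    then show ?thesis unfolding radical_def by blast
  qed
  have "S c \<in> radical ?I" if "c \<le> t" for c
  proof -
    have "(S c - a c * d) + a c * d \<in> radical ?I"
      using F[OF that] radical_superset
      by (intro ideal.subspace_add[OF I] ideal.subspace_scale[OF I] dI) blast
    then show ?thesis by simp
  qed
  then have uz: "u i * z j \<in> radical ?I" if "i \<le> j" "j \<le> t" for i j
    using that diagonal_sums_radical[of ?I t u z i j] by (simp add: S_def)
  have "F l \<in> ideal_gen G" if "l \<in> {1..t + 1}" for l
  proof -
    have "u i * z (i + (l - 1)) \<in> G" if "i \<in> {..t - (l - 1)}" for i
      unfolding G_def using that \<open>l \<in> {1..t + 1}\<close>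
      by (intro insertI2 CollectI exI[of _ i] exI[of _ "i + (l - 1)"]) auto
    then have "S (l - 1) \<in> ideal.span G"
      unfolding S_def by (intro ideal.span_sum ideal.span_base)
    moreover have "d \<in> ideal.span G" by (rule ideal.span_base) (simp add: G_def)
    ultimately show ?thesis
      unfolding F_def ideal_gen_def by (intro ideal.span_diff ideal.span_scale)
  qed
  then have "F ` {1..t + 1} \<subseteq> ideal_gen G" by blast
  moreover have "G \<subseteq> radical (ideal_gen (F ` {1..t + 1}))"
    unfolding G_def ideal_gen_def using dI uz by blast
  ultimately show ?thesis by (rule that)
qed

section \<open>Monomials, degree and evaluation\<close>

definition mon :: "('v \<Rightarrow>\<^sub>0 nat) \<Rightarrow> ('v, 'k::comm_ring_1) mpol" where
  "mon m = Poly_Mapping.single m 1"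

definition smul :: "'k::comm_ring_1 \<Rightarrow> ('v, 'k) mpol \<Rightarrow> ('v, 'k) mpol" where
  "smul c f = Poly_Mapping.single 0 c * f"

lemma mon_add: "mon (m + n) = mon m * mon n"
  by (simp add: mon_def mult_single)

lemma mon_0: "mon 0 = 1"
  by (simp add: mon_def)

lemma var_eq_mon: "var v = mon (Poly_Mapping.single v 1)"
  by (simp add: var_def mon_def)

lemma var_power: "var v ^ k = mon (Poly_Mapping.single v k)"
  by (induction k) (simp_all add: mon_0 var_eq_mon flip: mon_add single_add)

lemma lookup_mon: "Poly_Mapping.lookup (mon m) n = (if m = n then 1 else 0)"
  by (simp add: mon_def lookup_single when_def)

lemma keys_mon [simp]: "Poly_Mapping.keys (mon m :: ('v, 'k::comm_ring_1) mpol) = {m}"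
  by (simp add: mon_def)

lemma lookup_smul [simp]: "Poly_Mapping.lookup (smul c f) m = c * Poly_Mapping.lookup f m"
  unfolding smul_def mult_map_scale_conv_mult[symmetric] by (simp add: Poly_Mapping.map.rep_eq when_def)

interpretation mpol: vector_space "smul :: 'k::field \<Rightarrow> ('v, 'k) mpol \<Rightarrow> ('v, 'k) mpol"
  by unfold_locales (auto intro!: poly_mapping_eqI simp: lookup_add algebra_simps)

lemma smul_mult: "smul c f * g = smul c (f * g)"
  by (simp add: smul_def mult.assoc)

lemma ideal_imp_subspace:
  "ideal.subspace I \<Longrightarrow> mpol.subspace (I :: ('v, 'k::field) mpol set)"
  by (auto simp: mpol.subspace_def ideal.subspace_def smul_def)

lemma mpol_expand:
  "f = (\<Sum>m\<in>Poly_Mapping.keys f. smul (Poly_Mapping.lookup f m) (mon m))"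
  by (rule poly_mapping_eqI)
    (simp add: lookup_sum lookup_mon in_keys_iff if_distrib[of "\<lambda>x. _ * x"] cong: if_cong)

lemma mpol_in_span_mon:
  fixes f :: "('v, 'k::field) mpol"
  assumes "\<And>m. m \<in> Poly_Mapping.keys f \<Longrightarrow> mon m \<in> mpol.span B"
  shows "f \<in> mpol.span B"
  by (subst mpol_expand) (intro mpol.span_sum mpol.span_scale assms)

text \<open>The polynomials all of whose monomials lie in \<open>M\<close>; the filtrations by order and by degree below
are both of this form.\<close>

definition supp_space :: "('v \<Rightarrow>\<^sub>0 nat) set \<Rightarrow> ('v, 'k::field) mpol set" where
  "supp_space M = {f. Poly_Mapping.keys f \<subseteq> M}"

lemma subspace_supp_space:
  "mpol.subspace (supp_space M :: ('v, 'k::field) mpol set)"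
proof (rule mpol.subspaceI)
  fix f g :: "('v, 'k) mpol" and c
  show "f \<in> supp_space M \<Longrightarrow> g \<in> supp_space M \<Longrightarrow> f + g \<in> supp_space M"
    using keys_add[of f g] by (auto simp: supp_space_def)
  show "f \<in> supp_space M \<Longrightarrow> smul c f \<in> supp_space M"
    by (auto simp: supp_space_def in_keys_iff subset_iff)
qed (simp add: supp_space_def)

lemma span_mon_subset: "mpol.span (mon ` M) \<subseteq> supp_space M"
  by (rule mpol.span_minimal[OF _ subspace_supp_space]) (auto simp: supp_space_def)

text \<open>The total degree; it is meaningful only for finitely many indeterminates, since the sum over an
infinite type is \<open>0\<close>.\<close>

definition mdeg :: "('v \<Rightarrow>\<^sub>0 nat) \<Rightarrow> nat" where
  "mdeg m = (\<Sum>v\<in>UNIV. Poly_Mapping.lookup m v)"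

lemma mdeg_add [simp]: "mdeg (m + n) = mdeg m + mdeg n"
  by (simp add: mdeg_def lookup_add sum.distrib)

lemma mdeg_0 [simp]: "mdeg 0 = 0"
  by (simp add: mdeg_def)

lemma lookup_le_mdeg:
  "finite (UNIV :: 'v set) \<Longrightarrow> Poly_Mapping.lookup m (v :: 'v) \<le> mdeg m"
  unfolding mdeg_def by (rule member_le_sum) auto

lemma mdeg_single:
  "finite (UNIV :: 'v set) \<Longrightarrow> mdeg (Poly_Mapping.single (v :: 'v) k) = k"
  unfolding mdeg_def lookup_single when_def by (simp add: sum.delta)

lemma supp_space_mult:
  assumes "f \<in> supp_space M" "g \<in> supp_space N" "\<And>m n. m \<in> M \<Longrightarrow> n \<in> N \<Longrightarrow> m + n \<in> L"
  shows "f * g \<in> supp_space L"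
  using keys_mult[of f g] assms by (force simp: supp_space_def)

abbreviation deg_ge :: "nat \<Rightarrow> ('v, 'k::field) mpol set" where
  "deg_ge n \<equiv> supp_space {m. n \<le> mdeg m}"

abbreviation deg_le :: "nat \<Rightarrow> ('v, 'k::field) mpol set" where
  "deg_le n \<equiv> supp_space {m. mdeg m \<le> n}"

lemma deg_ge_mult: "f \<in> deg_ge m \<Longrightarrow> g \<in> deg_ge n \<Longrightarrow> f * g \<in> deg_ge (m + n)"
  by (erule (1) supp_space_mult) auto

lemma deg_le_mult: "f \<in> deg_le m \<Longrightarrow> g \<in> deg_le n \<Longrightarrow> f * g \<in> deg_le (m + n)"
  by (erule (1) supp_space_mult) auto

lemma deg_le_power: "f \<in> deg_le n \<Longrightarrow> f ^ a \<in> deg_le (a * n)"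
  by (induction a) (auto simp: deg_le_mult, auto simp: supp_space_def)

lemma deg_le_prod:
  "(\<And>i. i \<in> A \<Longrightarrow> f i \<in> deg_le (n i)) \<Longrightarrow> (\<Prod>i\<in>A. f i) \<in> deg_le (\<Sum>i\<in>A. n i)"
  by (induction A rule: infinite_finite_induct) (auto simp: deg_le_mult, auto simp: supp_space_def)

lemma deg_ge_power: "f \<in> deg_ge n \<Longrightarrow> f ^ a \<in> deg_ge (a * n)"
  by (induction a) (auto simp: deg_ge_mult, auto simp: supp_space_def)

lemma deg_ge_prod:
  "(\<And>i. i \<in> A \<Longrightarrow> f i \<in> deg_ge (n i)) \<Longrightarrow> (\<Prod>i\<in>A. f i) \<in> deg_ge (\<Sum>i\<in>A. n i)"
  by (induction A rule: infinite_finite_induct) (auto simp: deg_ge_mult, auto simp: supp_space_def)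

lemma ideal_deg_ge: "ideal.subspace (deg_ge n :: ('v, 'k::field) mpol set)"
proof (rule ideal.subspaceI)
  fix f g :: "('v, 'k) mpol"
  show "g \<in> deg_ge n \<Longrightarrow> f * g \<in> deg_ge n"
    using deg_ge_mult[of f 0 g n] by (simp add: supp_space_def)
qed (use subspace_supp_space mpol.subspace_def in blast)+

definition monval :: "('v \<Rightarrow> 'k::comm_ring_1) \<Rightarrow> ('v \<Rightarrow>\<^sub>0 nat) \<Rightarrow> 'k" where
  "monval p m = (\<Prod>v\<in>Poly_Mapping.keys m. p v ^ Poly_Mapping.lookup m v)"

lemma monval_superset:
  assumes "finite A" "Poly_Mapping.keys m \<subseteq> A"
  shows "monval p m = (\<Prod>v\<in>A. p v ^ Poly_Mapping.lookup m v)"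
  unfolding monval_def
  by (rule prod.mono_neutral_left) (use assms in \<open>auto simp: in_keys_iff\<close>)

lemma monval_add: "monval p (m + n) = monval p m * monval p n"
proof -
  let ?A = "Poly_Mapping.keys m \<union> Poly_Mapping.keys n"
  have "monval p (m + n) = (\<Prod>v\<in>?A. p v ^ Poly_Mapping.lookup (m + n) v)"
    by (rule monval_superset) (use keys_add[of m n] in auto)
  also have "\<dots> = monval p m * monval p n"
    by (simp add: monval_superset[of ?A] lookup_add power_add prod.distrib)
  finally show ?thesis .
qed

lemma eval_alt: "eval_mpol p f = (\<Sum>m\<in>Poly_Mapping.keys f. Poly_Mapping.lookup f m * monval p m)"
  by (simp add: eval_mpol_def monval_def)

lemma eval_add: "eval_mpol p (f + g) = eval_mpol p f + eval_mpol p g"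
  unfolding eval_alt by (rule setsum_keys_plus_distrib) (auto simp: algebra_simps)

lemma eval_0 [simp]: "eval_mpol p 0 = 0"
  by (simp add: eval_alt)

lemma eval_sum: "eval_mpol p (\<Sum>i\<in>A. f i) = (\<Sum>i\<in>A. eval_mpol p (f i))"
  by (induction A rule: infinite_finite_induct) (auto simp: eval_add)

lemma eval_mon: "eval_mpol p (mon m) = monval p m"
  by (simp add: eval_alt lookup_mon)

lemma eval_smul: "eval_mpol p (smul c f) = c * eval_mpol p f"
proof -
  have "eval_mpol p (smul c f)
      = (\<Sum>m\<in>Poly_Mapping.keys f. Poly_Mapping.lookup (smul c f) m * monval p m)"
    unfolding eval_alt by (rule sum.mono_neutral_left) (auto simp: in_keys_iff)
  then show ?thesis by (simp add: eval_alt sum_distrib_left mult.assoc)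
qed

lemma eval_mult:
  fixes f g :: "('v, 'k::comm_ring_1) mpol"
  shows "eval_mpol p (f * g) = eval_mpol p f * eval_mpol p g"
proof -
  let ?c = "Poly_Mapping.lookup" and ?K = "Poly_Mapping.keys"
  have smul2: "smul a x * smul b y = smul (a * b) (x * y)" for a b and x y :: "('v, 'k) mpol"
    by (simp add: smul_def mult_ac flip: mult_single[of 0 a 0 b, simplified])
  have "f * g = (\<Sum>m\<in>?K f. smul (?c f m) (mon m)) * (\<Sum>n\<in>?K g. smul (?c g n) (mon n))"
    by (simp flip: mpol_expand)
  also have "\<dots> = (\<Sum>m\<in>?K f. \<Sum>n\<in>?K g. smul (?c f m * ?c g n) (mon (m + n)))"
    by (simp add: sum_product smul2 mon_add)
  finally have "eval_mpol p (f * g)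
      = (\<Sum>m\<in>?K f. \<Sum>n\<in>?K g. (?c f m * ?c g n) * (monval p m * monval p n))"
    by (simp only: eval_sum eval_smul eval_mon monval_add)
  also have "\<dots> = eval_mpol p f * eval_mpol p g"
    unfolding eval_alt sum_product by (simp add: mult_ac)
  finally show ?thesis .
qed

lemma eval_1 [simp]: "eval_mpol p 1 = 1"
  using eval_mon[of p 0] by (simp add: mon_0 monval_def)

lemma eval_power: "eval_mpol p (f ^ n) = eval_mpol p f ^ n"
  by (induction n) (auto simp: eval_mult)

lemma eval_prod: "eval_mpol p (\<Prod>i\<in>A. f i) = (\<Prod>i\<in>A. eval_mpol p (f i))"
  by (induction A rule: infinite_finite_induct) (auto simp: eval_mult)

lemma eval_diff: "eval_mpol p (f - g) = eval_mpol p f - eval_mpol p g"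
  using eval_add[of p "f - g" g] by simp

lemma eval_var [simp]: "eval_mpol p (var v) = p v"
  by (simp add: var_eq_mon eval_mon monval_def)

lemma ideal_vanishing: "ideal.subspace {f. \<forall>p\<in>X. eval_mpol p f = 0}"
  by (rule ideal.subspaceI) (auto simp: eval_add eval_mult)

text \<open>The polynomials that vanish at a point form an ideal, so it is enough to look at generators.\<close>

lemma variety_ideal_gen: "variety (ideal_gen G) = variety G"
proof
  show "variety G \<subseteq> variety (ideal_gen G)"
  proof
    fix p assume "p \<in> variety G"
    then have "ideal_gen G \<subseteq> {f. \<forall>p\<in>{p}. eval_mpol p f = 0}"
      unfolding ideal_gen_def by (intro ideal.span_minimal ideal_vanishing) (auto simp: variety_def)
    then show "p \<in> variety (ideal_gen G)" by (auto simp: variety_def)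
  qed
qed (auto simp: variety_def ideal_gen_def ideal.span_base)

section \<open>Monomial curves and coordinate subspaces\<close>

text \<open>Evaluation at suitable weights distinguishes finitely many exponent vectors: read the exponents as
the digits of a number in a base \<open>b\<close> that exceeds all of them.\<close>

lemma separating_weights:
  fixes M :: "('v \<Rightarrow> nat) set"
  assumes "finite A" "finite M"
  shows "\<exists>w :: 'v \<Rightarrow> nat. \<forall>f\<in>M. \<forall>g\<in>M.
    (\<Sum>v\<in>A. w v * f v) = (\<Sum>v\<in>A. w v * g v) \<longrightarrow> (\<forall>v\<in>A. f v = g v)"
  using assms(1)
proof (induction A rule: finite_induct)
  case (insert a A)
  then obtain w :: "'v \<Rightarrow> nat" where w: "\<And>f g. f \<in> M \<Longrightarrow> g \<in> M \<Longrightarrow>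
      (\<Sum>v\<in>A. w v * f v) = (\<Sum>v\<in>A. w v * g v) \<Longrightarrow> (\<forall>v\<in>A. f v = g v)"
    by blast
  define b where "b = Suc (\<Sum>f\<in>M. f a)"
  have b: "f a < b" if "f \<in> M" for f
    using member_le_sum[of f M "\<lambda>f. f a"] that assms(2) by (simp add: b_def)
  define w' where "w' = (\<lambda>v. b * w v)(a := 1)"
  have w': "(\<Sum>v\<in>insert a A. w' v * f v) = f a + b * (\<Sum>v\<in>A. w v * f v)" for f
  proof -
    have "(\<Sum>v\<in>A. w' v * f v) = (\<Sum>v\<in>A. b * (w v * f v))"
      using insert.hyps(2) by (intro sum.cong) (auto simp: w'_def)
    then show ?thesis
      using insert.hyps by (simp add: w'_def sum_distrib_left)
  qed
  have "\<forall>v\<in>insert a A. f v = g v"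
    if fg: "f \<in> M" "g \<in> M" "(\<Sum>v\<in>insert a A. w' v * f v) = (\<Sum>v\<in>insert a A. w' v * g v)" for f g
  proof -
    have eq: "f a + b * (\<Sum>v\<in>A. w v * f v) = g a + b * (\<Sum>v\<in>A. w v * g v)"
      using fg(3) by (simp only: w')
    then have "(f a + b * (\<Sum>v\<in>A. w v * f v)) mod b = (g a + b * (\<Sum>v\<in>A. w v * g v)) mod b"
      by simp
    then have "f a = g a"
      using b fg by simp
    then have "b * (\<Sum>v\<in>A. w v * f v) = b * (\<Sum>v\<in>A. w v * g v)"
      using eq by simp
    then have "(\<Sum>v\<in>A. w v * f v) = (\<Sum>v\<in>A. w v * g v)"
      using b[OF fg(1)] by simp
    then show ?thesis using w[OF fg(1,2)] \<open>f a = g a\<close> by blast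
  qed
  then show ?case by blast
qed auto

text \<open>A point of the monomial curve \<open>\<tau> \<mapsto> (\<tau>\<^bsup>w v\<^esup>)\<^sub>v\<close> in the coordinate subspace that belongs to \<open>S\<close>.  If \<open>w\<close>
separates the monomials of a polynomial \<open>f\<close>, the restriction of \<open>f\<close> to the curve has the same
coefficients as the part of \<open>f\<close> that is supported on \<open>S\<close>, which reduces questions about zeros to one variable.\<close>

definition curve :: "('v \<Rightarrow> nat) \<Rightarrow> 'v set \<Rightarrow> 'k \<Rightarrow> 'v \<Rightarrow> 'k::field" where
  "curve w S \<tau> v = (if v \<in> S then \<tau> ^ w v else 0)"

definition weight :: "('v \<Rightarrow> nat) \<Rightarrow> ('v \<Rightarrow>\<^sub>0 nat) \<Rightarrow> nat" where
  "weight w m = (\<Sum>v\<in>UNIV. w v * Poly_Mapping.lookup m v)"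

text \<open>The restriction of \<open>f\<close> to the curve, as a polynomial in the parameter.\<close>

definition curve_poly :: "('v \<Rightarrow> nat) \<Rightarrow> 'v set \<Rightarrow> ('v, 'k::field) mpol \<Rightarrow> 'k poly" where
  "curve_poly w S f = (\<Sum>m | m \<in> Poly_Mapping.keys f \<and> Poly_Mapping.keys m \<subseteq> S.
     Polynomial.monom (Poly_Mapping.lookup f m) (weight w m))"

lemma monval_eq_0:
  "v \<in> Poly_Mapping.keys m \<Longrightarrow> p v = 0 \<Longrightarrow> monval p m = 0"
  unfolding monval_def by (rule prod_zero) (auto simp: in_keys_iff zero_power intro!: bexI[of _ v])

lemma monval_curve:
  assumes fin: "finite (UNIV :: 'v set)"
  shows "monval (curve w S \<tau> :: 'v \<Rightarrow> 'k::field) m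
    = (if Poly_Mapping.keys m \<subseteq> S then \<tau> ^ weight w m else 0)"
proof (cases "Poly_Mapping.keys m \<subseteq> S")
  case True
  have "monval (curve w S \<tau>) m = (\<Prod>v\<in>UNIV. curve w S \<tau> v ^ Poly_Mapping.lookup m v)"
    using fin by (rule monval_superset) simp
  also have "\<dots> = (\<Prod>v\<in>UNIV. \<tau> ^ (w v * Poly_Mapping.lookup m v))"
  proof (rule prod.cong[OF refl])
    fix v
    show "curve w S \<tau> v ^ Poly_Mapping.lookup m v = \<tau> ^ (w v * Poly_Mapping.lookup m v)"
      using True not_in_keys_iff_lookup_eq_zero[of v m]
      by (cases "v \<in> Poly_Mapping.keys m") (auto simp: curve_def power_mult)
  qed
  finally show ?thesis using True by (simp add: weight_def power_sum)
next
  case False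
  then obtain v where "v \<in> Poly_Mapping.keys m" "v \<notin> S" by blast
  then show ?thesis using False by (auto simp: curve_def intro: monval_eq_0)
qed

lemma eval_curve:
  fixes f :: "('v, 'k::field) mpol"
  assumes "finite (UNIV :: 'v set)"
  shows "eval_mpol (curve w S \<tau>) f = poly (curve_poly w S f) \<tau>"
proof -
  have "eval_mpol (curve w S \<tau>) f = (\<Sum>m\<in>Poly_Mapping.keys f.
      Poly_Mapping.lookup f m * (if Poly_Mapping.keys m \<subseteq> S then \<tau> ^ weight w m else 0))"
    by (simp only: eval_alt monval_curve[OF assms])
  also have "\<dots> = (\<Sum>m | m \<in> Poly_Mapping.keys f \<and> Poly_Mapping.keys m \<subseteq> S.
      Poly_Mapping.lookup f m * \<tau> ^ weight w m)"
    by (rule sum.mono_neutral_cong_right) auto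
  finally show ?thesis
    by (simp add: curve_poly_def poly_sum poly_monom)
qed

lemma curve_poly_nonzero:
  assumes inj: "inj_on (weight w) {m \<in> Poly_Mapping.keys f. Poly_Mapping.keys m \<subseteq> S}"
    and m: "m \<in> Poly_Mapping.keys f" "Poly_Mapping.keys m \<subseteq> S"
  shows "curve_poly w S f \<noteq> 0"
proof -
  let ?K = "{m \<in> Poly_Mapping.keys f. Poly_Mapping.keys m \<subseteq> S}"
  have "coeff (curve_poly w S f) (weight w m)
      = (\<Sum>n\<in>?K. if weight w n = weight w m then Poly_Mapping.lookup f n else 0)"
    by (simp add: curve_poly_def coeff_sum)
  also have "\<dots> = (\<Sum>n\<in>?K. if n = m then Poly_Mapping.lookup f n else 0)"
    using inj m by (intro sum.cong) (auto simp: inj_on_def)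
  also have "\<dots> = Poly_Mapping.lookup f m"
    using m by simp
  finally show ?thesis using m by (auto simp: in_keys_iff)
qed

lemma poly_eq_0_infinite:
  fixes P :: "'k::field poly"
  assumes "infinite (UNIV :: 'k set)" "\<And>\<tau>. poly P \<tau> = 0"
  shows "P = 0"
  using assms poly_roots_finite[of P] by auto

lemma vanishing_on_curve:
  fixes f :: "('v, 'k::field) mpol"
  assumes "infinite (UNIV :: 'k set)" "finite (UNIV :: 'v set)"
    and "inj_on (weight w) {m \<in> Poly_Mapping.keys f. Poly_Mapping.keys m \<subseteq> S}"
    and "\<And>\<tau>. eval_mpol (curve w S \<tau>) f = 0"
    and "m \<in> Poly_Mapping.keys f"
  shows "\<not> Poly_Mapping.keys m \<subseteq> S"
  using curve_poly_nonzero[OF assms(3,5)] poly_eq_0_infinite[OF assms(1)] assms(4)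
  by (metis eval_curve[OF assms(2)])

lemma injective_weight:
  assumes fin: "finite (UNIV :: 'v set)" and "finite K"
  obtains w :: "'v \<Rightarrow> nat" where "inj_on (weight w) K"
proof -
  obtain w :: "'v \<Rightarrow> nat" where w: "\<forall>f\<in>Poly_Mapping.lookup ` K. \<forall>g\<in>Poly_Mapping.lookup ` K.
      (\<Sum>v\<in>UNIV. w v * f v) = (\<Sum>v\<in>UNIV. w v * g v) \<longrightarrow> (\<forall>v\<in>UNIV. f v = g v)"
    using separating_weights[OF fin, of "Poly_Mapping.lookup ` K"] assms(2) by blast
  have "inj_on (weight w) K"
  proof (rule inj_onI)
    fix m n assume mn: "m \<in> K" "n \<in> K" and eq: "weight w m = weight w n"
    from bspec[OF bspec[OF w imageI[OF mn(1)]] imageI[OF mn(2)]] eq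
    have "\<forall>v. Poly_Mapping.lookup m v = Poly_Mapping.lookup n v"
      unfolding weight_def by blast
    then show "m = n" by (simp add: poly_mapping_eqI)
  qed
  then show ?thesis by (rule that)
qed

text \<open>Over a finite field, \<open>\<Prod>\<^sub>a (X - a) + 1\<close> would have no root.\<close>

lemma infinite_alg_closed: "infinite (UNIV :: 'k::alg_closed_field set)"
proof
  assume fin: "finite (UNIV :: 'k set)"
  define P where "P = (\<Prod>a\<in>(UNIV :: 'k set). [:- a, 1:]) + 1"
  have "degree (\<Prod>a\<in>(UNIV :: 'k set). [:- a, 1:]) = card (UNIV :: 'k set)"
    by (subst degree_prod_eq_sum_degree) auto
  then have "degree P > 0"
    using fin by (simp add: P_def degree_add_eq_left card_gt_0_iff)
  then obtain x where "poly P x = 0"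
    using alg_closed_imp_poly_has_root by blast
  moreover have "poly P x = 1"
    using fin by (simp add: P_def poly_prod prod_zero[OF fin])
  ultimately show False by simp
qed

definition coordinate_space :: "'v set \<Rightarrow> ('v \<Rightarrow> 'k::field) set" where
  "coordinate_space S = {p. \<forall>v. v \<notin> S \<longrightarrow> p v = 0}"

lemma coordinate_space_eq_variety: "coordinate_space S = variety (var ` (- S))"
  by (auto simp: coordinate_space_def variety_def)

text \<open>If the subspace is the union of two proper closed subsets, there are polynomials \<open>f\<close> and \<open>g\<close> that
vanish on one of them each but have a monomial that survives on the subspace.  On a monomial curve
separating the monomials of both, neither restriction is the zero polynomial, but their product
vanishes for every parameter.\<close>

lemma irreducible_coordinate_space:
  assumes inf: "infinite (UNIV :: 'k::field set)" and fin: "finite (UNIV :: 'v set)"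
  shows "irreducible_closed (coordinate_space S :: ('v \<Rightarrow> 'k) set)"
  unfolding irreducible_closed_def
proof (intro conjI allI impI)
  let ?C = "coordinate_space S :: ('v \<Rightarrow> 'k) set"
  show "zariski_closed ?C"
    unfolding zariski_closed_def coordinate_space_eq_variety by blast
  have "(\<lambda>_. 0) \<in> ?C" by (simp add: coordinate_space_def)
  then show "?C \<noteq> {}" by blast
  fix A B :: "('v \<Rightarrow> 'k) set"
  assume *: "zariski_closed A \<and> zariski_closed B \<and> ?C = A \<union> B"
  show "A = ?C \<or> B = ?C"
  proof (rule ccontr)
    have ex: "\<exists>f m. (\<forall>p\<in>X. eval_mpol p f = 0) \<and> m \<in> Poly_Mapping.keys f \<and> Poly_Mapping.keys m \<subseteq> S"
      if X: "zariski_closed X" "X \<subseteq> ?C" "X \<noteq> ?C" for X :: "('v \<Rightarrow> 'k) set"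
    proof -
      obtain G where G: "X = variety G" using X(1) by (auto simp: zariski_closed_def)
      obtain p where p: "p \<in> ?C" "p \<notin> X" using X by blast
      then obtain f where f: "f \<in> G" "eval_mpol p f \<noteq> 0" by (auto simp: G variety_def)
      then obtain m where m: "m \<in> Poly_Mapping.keys f" "monval p m \<noteq> 0"
        unfolding eval_alt by (metis (no_types, lifting) mult_zero_right sum.neutral)
      then have "Poly_Mapping.keys m \<subseteq> S"
        using p(1) monval_eq_0[of _ m p] by (auto simp: coordinate_space_def)
      then show ?thesis using f m by (auto simp: G variety_def)
    qed
    assume "\<not> (A = ?C \<or> B = ?C)"
    then obtain f m g n where
      f: "\<forall>p\<in>A. eval_mpol p f = 0" "m \<in> Poly_Mapping.keys f" "Poly_Mapping.keys m \<subseteq> S" and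
      g: "\<forall>p\<in>B. eval_mpol p g = 0" "n \<in> Poly_Mapping.keys g" "Poly_Mapping.keys n \<subseteq> S"
      using ex[of A] ex[of B] * by blast
    let ?K = "Poly_Mapping.keys f \<union> Poly_Mapping.keys g"
    obtain w where w: "inj_on (weight w) ?K"
      using injective_weight[OF fin, of ?K] by auto
    have "poly (curve_poly w S f * curve_poly w S g) \<tau> = 0" for \<tau>
    proof -
      have "curve w S \<tau> \<in> A \<union> B"
        using * by (auto simp: coordinate_space_def curve_def)
      then show ?thesis using f(1) g(1) by (auto simp flip: eval_curve[OF fin])
    qed
    then have "curve_poly w S f * curve_poly w S g = 0"
      by (rule poly_eq_0_infinite[OF inf])
    moreover have "curve_poly w S f \<noteq> 0" "curve_poly w S g \<noteq> 0"
      by (auto intro!: curve_poly_nonzero[OF _ f(2,3)] curve_poly_nonzero[OF _ g(2,3)]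
          intro: inj_on_subset[OF w])
    ultimately show False by simp
  qed
qed

section \<open>Chains of irreducible closed sets\<close>

lemma irreducible_closed_prime:
  assumes C: "irreducible_closed C" and fg: "\<And>p. p \<in> C \<Longrightarrow> eval_mpol p (f * g) = 0"
  shows "(\<forall>p\<in>C. eval_mpol p f = 0) \<or> (\<forall>p\<in>C. eval_mpol p g = 0)"
proof -
  obtain G where G: "C = variety G"
    using C by (auto simp: irreducible_closed_def zariski_closed_def)
  have "C = variety (insert f G) \<union> variety (insert g G)"
    using fg by (auto simp: G variety_def eval_mult)
  moreover have "zariski_closed (variety (insert h G))" for h
    by (auto simp: zariski_closed_def)
  ultimately have "variety (insert f G) = C \<or> variety (insert g G) = C"
    using C unfolding irreducible_closed_def by blast
  then show ?thesis by (auto simp: variety_def)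
qed

text \<open>Choose \<open>f\<^sub>i\<close> vanishing on \<open>C\<^sub>i\<close> but not on \<open>C\<^bsub>i+1\<^esub>\<close>.  The monomials in \<open>f\<^sub>0, \<dots>, f\<^bsub>j-1\<^esub>\<close> are linearly
independent as functions on \<open>C\<^sub>j\<close>: in a relation on \<open>C\<^bsub>j+1\<^esub>\<close>, divide by the least power of \<open>f\<^sub>j\<close> that
occurs, which irreducibility permits, and restrict to \<open>C\<^sub>j\<close>.  Only the terms with the least exponent of
\<open>f\<^sub>j\<close> survive there, and they form a relation between monomials in the remaining \<open>f\<^sub>i\<close>.  Exponent
vectors are functions on all natural numbers, of which only the first \<open>j\<close> values count; the
premise on pairs from \<open>A\<close> says that these values tell its members apart.\<close>

lemma chain_algebraically_independent:
  fixes f :: "nat \<Rightarrow> ('v, 'k::field) mpol"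
  assumes irr: "\<And>i. i \<le> n \<Longrightarrow> irreducible_closed (C i)"
    and chain: "\<And>i. i < n \<Longrightarrow> C i \<subseteq> C (Suc i)"
    and zero: "\<And>i p. i < n \<Longrightarrow> p \<in> C i \<Longrightarrow> eval_mpol p (f i) = 0"
    and nonzero: "\<And>i. i < n \<Longrightarrow> \<exists>p\<in>C (Suc i). eval_mpol p (f i) \<noteq> 0"
  shows "j \<le> n \<Longrightarrow> finite A \<Longrightarrow>
    (\<And>a b. a \<in> A \<Longrightarrow> b \<in> A \<Longrightarrow> (\<And>i. i < j \<Longrightarrow> a i = b i) \<Longrightarrow> a = b) \<Longrightarrow>
    (\<And>p. p \<in> C j \<Longrightarrow> eval_mpol p (\<Sum>a\<in>A. smul (c a) (\<Prod>i<j. f i ^ a i)) = 0) \<Longrightarrow>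
    a \<in> A \<Longrightarrow> c a = 0"
proof (induction j arbitrary: A a)
  case 0
  then have "A = {a}" by blast
  moreover obtain p where "p \<in> C 0"
    using irr[of 0] by (auto simp: irreducible_closed_def)
  ultimately show ?case
    using "0.prems"(4) by (simp add: eval_smul)
next
  case (Suc j)
  note dist = Suc.prems(3)
  show ?case
  proof (rule ccontr)
    assume "c a \<noteq> 0"
    define A' where "A' = {a \<in> A. c a \<noteq> 0}"
    define k where "k = Min ((\<lambda>a. a j) ` A')"
    have A': "finite A'" "A' \<noteq> {}"
      using Suc.prems(2,5) \<open>c a \<noteq> 0\<close> by (auto simp: A'_def)
    have k: "k \<le> b j" if "b \<in> A'" for b
      using A' that by (auto simp: k_def)
    have "k \<in> (\<lambda>a. a j) ` A'"
      unfolding k_def using A' by (intro Min_in) auto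
    then obtain b where b: "b \<in> A'" "b j = k" by blast
    define h where "h = (\<Sum>a\<in>A'. smul (c a) (f j ^ (a j - k) * (\<Prod>i<j. f i ^ a i)))"
    have "(\<Sum>a\<in>A. smul (c a) (\<Prod>i<Suc j. f i ^ a i))
        = (\<Sum>a\<in>A'. smul (c a) (\<Prod>i<Suc j. f i ^ a i))"
      using Suc.prems(2) by (intro sum.mono_neutral_right) (auto simp: A'_def)
    also have "\<dots> = f j ^ k * h"
      unfolding h_def sum_distrib_left
    proof (rule sum.cong[OF refl])
      fix a assume "a \<in> A'"
      have "f j ^ a j = f j ^ k * f j ^ (a j - k)"
        using k[OF \<open>a \<in> A'\<close>] by (simp flip: power_add)
      then show "smul (c a) (\<Prod>i<Suc j. f i ^ a i)
          = f j ^ k * smul (c a) (f j ^ (a j - k) * (\<Prod>i<j. f i ^ a i))"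
        by (simp add: smul_def mult_ac)
    qed
    finally have fac: "(\<Sum>a\<in>A. smul (c a) (\<Prod>i<Suc j. f i ^ a i)) = f j ^ k * h" .
    have "eval_mpol p (f j ^ k * h) = 0" if "p \<in> C (Suc j)" for p
      using Suc.prems(4)[OF that] by (simp only: fac)
    then have "(\<forall>p\<in>C (Suc j). eval_mpol p (f j ^ k) = 0) \<or> (\<forall>p\<in>C (Suc j). eval_mpol p h = 0)"
      using irr Suc.prems(1) by (intro irreducible_closed_prime) auto
    then have h0: "\<forall>p\<in>C (Suc j). eval_mpol p h = 0"
      using nonzero[of j] Suc.prems(1) by (auto simp: eval_power)
    define A'' where "A'' = {a \<in> A'. a j = k}"
    have "eval_mpol p (\<Sum>a\<in>A''. smul (c a) (\<Prod>i<j. f i ^ a i)) = 0" if p: "p \<in> C j" for p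
    proof -
      have "eval_mpol p h = (\<Sum>a\<in>A'. c a * (eval_mpol p (f j) ^ (a j - k)
          * (\<Prod>i<j. eval_mpol p (f i) ^ a i)))"
        by (simp add: h_def eval_sum eval_smul eval_mult eval_power eval_prod)
      also have "\<dots> = (\<Sum>a\<in>A''. c a * (\<Prod>i<j. eval_mpol p (f i) ^ a i))"
        using A'(1) zero[of j p] p Suc.prems(1) k
        by (intro sum.mono_neutral_cong_right) (force simp: A''_def power_0_left)+
      also have "\<dots> = eval_mpol p (\<Sum>a\<in>A''. smul (c a) (\<Prod>i<j. f i ^ a i))"
        by (simp add: eval_sum eval_smul eval_power eval_prod)
      finally show ?thesis
        using h0 chain[of j] p Suc.prems(1) by auto
    qed
    moreover have "a = a'" if "a \<in> A''" "a' \<in> A''" "\<And>i. i < j \<Longrightarrow> a i = a' i" for a a'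
    proof (rule dist)
      show "a i = a' i" if "i < Suc j" for i
        using that \<open>a \<in> A''\<close> \<open>a' \<in> A''\<close> \<open>\<And>i. i < j \<Longrightarrow> a i = a' i\<close>
        by (cases "i = j") (auto simp: A''_def)
    qed (use that in \<open>auto simp: A''_def A'_def\<close>)
    moreover have "finite A''" "b \<in> A''" using A'(1) b by (auto simp: A''_def)
    ultimately have "c b = 0"
      using Suc.prems(1) by (intro Suc.IH[of A'']) auto
    then show False using b by (simp add: A'_def)
  qed
qed

lemma ex_deg_le: "\<exists>D. f \<in> deg_le D"
proof -
  have "mdeg m \<le> (\<Sum>m\<in>Poly_Mapping.keys f. mdeg m)" if "m \<in> Poly_Mapping.keys f" for m
    using that by (intro member_le_sum) auto
  then show ?thesis by (auto simp: supp_space_def)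
qed

lemma deg_le_mono: "f \<in> deg_le m \<Longrightarrow> m \<le> n \<Longrightarrow> f \<in> deg_le n"
  by (auto simp: supp_space_def)

text \<open>If the polynomials of degree at most \<open>D\<close> span a space of dimension \<open>O(D\<^sup>d)\<close> modulo an ideal that
vanishes on \<open>V\<close>, then chains in \<open>V\<close> have length at most \<open>d\<close>.  Otherwise the \<open>q\<^sup>n\<close> monomials with
exponents below \<open>q\<close> in the \<open>f\<^sub>i\<close> of a chain of length \<open>n > d\<close> have degree \<open>O(q)\<close>, so for large \<open>q\<close>
they outnumber the dimension and satisfy a nontrivial relation on \<open>V\<close>, against their independence.\<close>

lemma chain_length_le_growth:
  fixes I :: "('v, 'k::field) mpol set"
  assumes I: "mpol.subspace I" and van: "\<And>f p. f \<in> I \<Longrightarrow> p \<in> V \<Longrightarrow> eval_mpol p f = 0"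
    and growth: "\<And>D. \<exists>B. finite B \<and> card B \<le> K * (D + 1) ^ d \<and> deg_le D \<subseteq> mpol.span (B \<union> I)"
    and irr: "\<And>i. i \<le> n \<Longrightarrow> irreducible_closed (C i) \<and> C i \<subseteq> V"
    and chain: "\<And>i. i < n \<Longrightarrow> C i \<subset> C (Suc i)"
  shows "n \<le> d"
proof (rule ccontr)
  assume "\<not> n \<le> d"
  have "\<exists>f. (\<forall>p\<in>C i. eval_mpol p f = 0) \<and> (\<exists>p\<in>C (Suc i). eval_mpol p f \<noteq> 0)" if i: "i < n" for i
  proof -
    have "irreducible_closed (C i)" using irr[of i] i by simp
    then obtain G where G: "C i = variety G"
      unfolding irreducible_closed_def zariski_closed_def by blast
    obtain p where "p \<in> C (Suc i)" "p \<notin> C i" using chain[OF i] by blast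
    then show ?thesis unfolding G by (auto simp: variety_def)
  qed
  then obtain f where f: "\<And>i p. i < n \<Longrightarrow> p \<in> C i \<Longrightarrow> eval_mpol p (f i) = 0"
    "\<And>i. i < n \<Longrightarrow> \<exists>p\<in>C (Suc i). eval_mpol p (f i) \<noteq> 0"
    by metis
  have "\<forall>i. \<exists>D. f i \<in> deg_le D" by (simp only: ex_deg_le simp_thms)
  from choice[OF this] obtain Di where Di: "\<And>i. f i \<in> deg_le (Di i)" by blast
  define D where "D = (\<Sum>i<n. Di i)"
  have D: "f i \<in> deg_le D" if "i < n" for i
    by (rule deg_le_mono[OF Di]) (use that member_le_sum[of i "{..<n}" Di] in \<open>auto simp: D_def\<close>)
  \<comment> \<open>With this \<open>q\<close>, the bound \<open>K (n D + 1) ^ d q ^ d\<close> for the dimension is below \<open>q ^ (d + 1)\<close>.\<close>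
  define q where "q = Suc (K * (n * D + 1) ^ d)"
  define A where "A = {..<n} \<rightarrow>\<^sub>E {..<q}"
  define \<phi> where "\<phi> a = (\<Prod>i<n. f i ^ a i)" for a :: "nat \<Rightarrow> nat"
  have A: "finite A" "card A = q ^ n"
    by (auto simp: A_def finite_PiE card_PiE)
  obtain B where B: "finite B" "card B \<le> K * (n * q * D + 1) ^ d"
    "deg_le (n * q * D) \<subseteq> mpol.span (B \<union> I)"
    using growth by blast
  have "\<phi> a \<in> mpol.span (B \<union> I)" if "a \<in> A" for a
  proof -
    have "f i ^ a i \<in> deg_le (q * D)" if "i < n" for i
    proof (rule deg_le_mono[OF deg_le_power[OF D[OF that]]])
      show "a i * D \<le> q * D"
        using \<open>a \<in> A\<close> that by (intro mult_right_mono) (auto simp: A_def PiE_iff less_imp_le)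
    qed
    then have "\<phi> a \<in> deg_le (\<Sum>i<n. q * D)"
      unfolding \<phi>_def by (intro deg_le_prod) auto
    then show ?thesis using B(3) by (auto simp: mult.assoc)
  qed
  moreover have "card B < card A"
  proof -
    have "n * q * D + 1 \<le> q * (n * D + 1)" by (simp add: q_def algebra_simps)
    then have "K * (n * q * D + 1) ^ d \<le> K * (q * (n * D + 1)) ^ d"
      by (intro mult_left_mono power_mono) auto
    also have "\<dots> = (K * (n * D + 1) ^ d) * q ^ d"
      by (simp only: power_mult_distrib mult_ac)
    also have "\<dots> < q * q ^ d"
      by (intro mult_strict_right_mono) (auto simp: q_def)
    also have "\<dots> \<le> q ^ n"
      using \<open>\<not> n \<le> d\<close> power_increasing[of "Suc d" n q] by (simp add: q_def)
    finally show ?thesis using B(2) A(2) by simp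
  qed
  ultimately obtain c where c: "\<exists>a\<in>A. c a \<noteq> 0" "(\<Sum>a\<in>A. smul (c a) (\<phi> a)) \<in> I"
    using mpol.nontrivial_relation_modulo_subspace[OF B(1) I A(1)] by blast
  have "c a = 0" if "a \<in> A" for a
  proof (rule chain_algebraically_independent[where C = C and f = f and n = n and j = n and A = A and c = c])
    show "a = b" if "a \<in> A" "b \<in> A" "\<And>i. i < n \<Longrightarrow> a i = b i" for a b
      using that unfolding A_def by (intro PiE_ext) auto
    show "eval_mpol p (\<Sum>a\<in>A. smul (c a) (\<Prod>i<n. f i ^ a i)) = 0" if "p \<in> C n" for p
      using van[OF c(2)] irr[of n] that by (auto simp: \<phi>_def)
  qed (use irr chain f A that in auto)
  then show False using c(1) by blast
qed

text \<open>A flag of coordinate subspaces.\<close>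

lemma coordinate_space_chain:
  assumes inf: "infinite (UNIV :: 'k::field set)" and fin: "finite (UNIV :: 'v set)"
    and sub: "coordinate_space S \<subseteq> (V :: ('v \<Rightarrow> 'k) set)"
  shows "\<exists>C. (\<forall>i\<le>card S. irreducible_closed (C i) \<and> C i \<subseteq> V) \<and> (\<forall>i<card S. C i \<subset> C (Suc i))"
proof -
  obtain h where h: "bij_betw h {0..<card S} S"
    using ex_bij_betw_nat_finite[OF finite_subset[OF subset_UNIV fin]] by blast
  define C where "C i = (coordinate_space (h ` {..<i}) :: ('v \<Rightarrow> 'k) set)" for i
  have "C i \<subseteq> V" if "i \<le> card S" for i
  proof -
    have "h ` {..<i} \<subseteq> S" using h that by (auto simp: bij_betw_def)
    then show ?thesis using sub by (fastforce simp: C_def coordinate_space_def)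
  qed
  moreover have "C i \<subset> C (Suc i)" if "i < card S" for i
  proof -
    have "h i \<notin> h ` {..<i}"
      using h that inj_onD[of h "{0..<card S}" i] by (force simp: bij_betw_def)
    then have "(\<lambda>v. if v = h i then 1 else 0) \<in> C (Suc i) - C i"
      by (auto simp: C_def coordinate_space_def)
    moreover have "C i \<subseteq> C (Suc i)" by (fastforce simp: C_def coordinate_space_def)
    ultimately show ?thesis by blast
  qed
  ultimately show ?thesis
    using irreducible_coordinate_space[OF inf fin] by (intro exI[of _ C]) (auto simp: C_def)
qed

section \<open>Growth modulo an ideal and the number of its generators\<close>

lemma lookup_Abs_finite:
  "finite (UNIV :: 'v set) \<Longrightarrow> Poly_Mapping.lookup (Abs_poly_mapping f) = (f :: 'v \<Rightarrow> nat)"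
  by (rule lookup_Abs_poly_mapping) (rule finite_subset[OF subset_UNIV])

text \<open>Choose the set of at most \<open>d\<close> positions with large exponents in one of \<open>2\<^sup>N\<close> ways; these have at
most \<open>D + 1\<close> values each and the other positions at most \<open>k\<close>.  Thus the count is \<open>O(D\<^sup>d)\<close> for fixed \<open>k\<close>.\<close>

lemma card_few_large_exponents:
  fixes k d D :: nat
  assumes fin: "finite (UNIV :: 'v set)" and "1 \<le> k"
  defines "M \<equiv> {m :: 'v \<Rightarrow>\<^sub>0 nat. (\<forall>v. Poly_Mapping.lookup m v \<le> D) \<and>
     card {v. k \<le> Poly_Mapping.lookup m v} \<le> d}"
  shows "finite M" "card M \<le> 2 ^ card (UNIV :: 'v set) * k ^ card (UNIV :: 'v set) * (D + 1) ^ d"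
proof -
  let ?N = "card (UNIV :: 'v set)"
  let ?P = "\<lambda>S :: 'v set. \<Pi>\<^sub>E v\<in>UNIV. if v \<in> S then {..D} else {..<k}"
  let ?S = "{S :: 'v set. card S \<le> d}"
  have finPow: "finite (Pow (UNIV :: 'v set))" using fin by (simp only: finite_Pow_iff)
  have finS: "finite ?S" using finPow by (rule rev_finite_subset) auto
  have finP: "finite (?P S)" for S by (rule finite_PiE[OF fin]) auto
  have sub: "Poly_Mapping.lookup ` M \<subseteq> (\<Union>S\<in>?S. ?P S)"
  proof (intro subsetI, elim imageE)
    fix f m assume fm: "f = Poly_Mapping.lookup m" "m \<in> M"
    then have "f \<in> ?P {v. k \<le> Poly_Mapping.lookup m v}"
      by (auto simp: M_def)
    then show "f \<in> (\<Union>S\<in>?S. ?P S)" using fm by (auto simp: M_def)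
  qed
  have inj: "inj_on Poly_Mapping.lookup M" by (auto intro!: inj_onI poly_mapping_eqI)
  have fin2: "finite (\<Union>S\<in>?S. ?P S)" using finS finP by blast
  show "finite M" using inj finite_subset[OF sub fin2] by (rule finite_imageD[rotated])
  have cardP: "card (?P S) \<le> k ^ ?N * (D + 1) ^ d" if "S \<in> ?S" for S
  proof -
    have "card (?P S) = (\<Prod>v\<in>UNIV. if v \<in> S then D + 1 else k)"
      by (subst card_PiE[OF fin]) (auto intro!: prod.cong)
    also have "\<dots> \<le> (\<Prod>v\<in>UNIV. k * (if v \<in> S then D + 1 else 1))"
      using mult_right_mono[OF \<open>1 \<le> k\<close>, of "D + 1"] \<open>1 \<le> k\<close> by (intro prod_mono) auto
    also have "\<dots> = k ^ ?N * (D + 1) ^ card S"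
      using fin by (simp add: prod.distrib prod.If_cases)
    also have "\<dots> \<le> k ^ ?N * (D + 1) ^ d"
      using that by (intro mult_left_mono power_increasing) auto
    finally show ?thesis .
  qed
  have "card M = card (Poly_Mapping.lookup ` M)" using inj by (simp add: card_image)
  also have "\<dots> \<le> card (\<Union>S\<in>?S. ?P S)" using fin2 sub by (rule card_mono)
  also have "\<dots> \<le> (\<Sum>S\<in>?S. card (?P S))" using finS by (rule card_UN_le)
  also have "\<dots> \<le> (\<Sum>S\<in>?S. k ^ ?N * (D + 1) ^ d)" using cardP by (rule sum_mono)
  also have "\<dots> = card ?S * (k ^ ?N * (D + 1) ^ d)" by simp
  also have "\<dots> \<le> 2 ^ ?N * (k ^ ?N * (D + 1) ^ d)"
    using card_mono[OF finPow, of ?S] fin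
    by (intro mult_right_mono) (simp_all only: card_Pow, auto)
  finally show "card M \<le> 2 ^ ?N * k ^ ?N * (D + 1) ^ d" by (simp add: mult.assoc)
qed

text \<open>An ideal generated by \<open>r\<close> polynomials without constant term, modulo which the growth is \<open>O(D\<^sup>d)\<close>,
satisfies \<open>N \<le> d + r\<close> in \<open>N\<close> indeterminates; this plays the part of Krull's height theorem.
Expanding a polynomial repeatedly along the \<open>F\<^sub>i\<close> shows that, up to terms of order at least \<open>n\<close>, it is
a combination of products \<open>b F\<^sup>a\<close>, where \<open>b\<close> runs over \<open>O(n\<^sup>d)\<close> representatives and all exponents in \<open>a\<close>
are below \<open>n\<close>, because \<open>F\<^sup>a\<close> has order at least the sum of the \<open>a\<^sub>i\<close>.  There are \<open>O(n\<^bsup>d+r\<^esup>)\<close> such products,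
while the monomials of degree below \<open>n\<close> are independent modulo order \<open>n\<close> and their number grows
like \<open>n\<^sup>N\<close>.\<close>

lemma number_of_equations_growth:
  fixes F :: "nat \<Rightarrow> ('v, 'k::field) mpol"
  assumes fin: "finite (UNIV :: 'v set)"
    and F: "\<And>i. i \<in> {1..r} \<Longrightarrow> F i \<in> deg_ge 1"
    and growth: "\<And>D. \<exists>B. finite B \<and> card B \<le> K * (D + 1) ^ d \<and>
      deg_le D \<subseteq> mpol.span (B \<union> ideal_gen (F ` {1..r}))"
  shows "card (UNIV :: 'v set) \<le> d + r"
proof (rule ccontr)
  let ?N = "card (UNIV :: 'v set)"
  let ?I = "ideal.span (F ` {1..r})"
  assume "\<not> ?N \<le> d + r"
  \<comment> \<open>With \<open>n = N q\<close>, the \<open>q ^ N\<close> monomials with all exponents below \<open>q\<close> have degree below \<open>n\<close>.\<close>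
  define q where "q = Suc (K * (?N + 1) ^ (d + r))"
  define n where "n = ?N * q"
  have "0 < n" using \<open>\<not> ?N \<le> d + r\<close> by (simp add: n_def q_def)
  define \<Phi> where "\<Phi> a = (\<Prod>i\<in>{1..r}. F i ^ a i)" for a :: "nat \<Rightarrow> nat"
  obtain B where B: "finite B" "card B \<le> K * (n + 1) ^ d" "deg_le n \<subseteq> mpol.span (B \<union> ?I)"
    using growth[of n] by (auto simp: ideal_gen_def)
  define E where "E = {1..r} \<rightarrow>\<^sub>E {..<n}"
  define T where "T = (\<lambda>(b, a). b * \<Phi> a) ` (B \<times> E)"
  have E: "finite E" "card E = n ^ r"
    by (auto simp: E_def finite_PiE card_PiE)
  have T: "finite T" "card T \<le> K * (n + 1) ^ d * n ^ r"
  proof -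
    show "finite T" using B E by (simp add: T_def)
    have "card T \<le> card (B \<times> E)" unfolding T_def by (rule card_image_le) (use B E in auto)
    also have "\<dots> = card B * n ^ r" by (simp add: card_cartesian_product E)
    also have "\<dots> \<le> K * (n + 1) ^ d * n ^ r" by (rule mult_right_mono[OF B(2)]) simp
    finally show "card T \<le> K * (n + 1) ^ d * n ^ r" .
  qed
  let ?W = "mpol.span (T \<union> deg_ge n)"
  have high: "f \<in> ?W" if "f \<in> deg_ge n" for f
    using that by (intro mpol.span_base) auto
  \<comment> \<open>Every expansion step raises the order of \<open>\<Phi> a\<close>, so the induction runs from high exponents down.\<close>
  have all: "h * \<Phi> a \<in> ?W" for h a
  proof (induction "n - (\<Sum>i\<in>{1..r}. a i)" arbitrary: h a rule: less_induct)
    case less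
    show ?case
    proof (cases "n \<le> (\<Sum>i\<in>{1..r}. a i)")
      case True
      have "\<Phi> a \<in> deg_ge (\<Sum>i\<in>{1..r}. a i * 1)"
        unfolding \<Phi>_def by (intro deg_ge_prod deg_ge_power F)
      then have "\<Phi> a \<in> deg_ge n"
        using True by (auto simp: supp_space_def)
      then show ?thesis by (intro high ideal.subspace_scale[OF ideal_deg_ge])
    next
      case False
      define X where "X = {h. h * \<Phi> a \<in> ?W}"
      have X: "mpol.subspace X"
        by (rule mpol.subspaceI)
          (auto simp: X_def distrib_right smul_mult intro: mpol.span_zero mpol.span_add mpol.span_scale)
      have "B \<subseteq> X"
      proof
        fix b assume "b \<in> B"
        have "a i < n" if "i \<in> {1..r}" for i
          using member_le_sum[of i "{1..r}" a] that False by auto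
        then have "restrict a {1..r} \<in> E" by (auto simp: E_def)
        then have "b * \<Phi> (restrict a {1..r}) \<in> T" using \<open>b \<in> B\<close> by (auto simp: T_def)
        moreover have "\<Phi> (restrict a {1..r}) = \<Phi> a" unfolding \<Phi>_def by (intro prod.cong) auto
        ultimately show "b \<in> X" by (auto simp: X_def intro: mpol.span_base)
      qed
      moreover have "?I \<subseteq> X"
      proof
        fix f assume "f \<in> ?I"
        then show "f \<in> X"
        proof (induction rule: ideal.span_induct_alt)
          case base
          show ?case using X by (rule mpol.subspace_0)
        next
          case (step c f g)
          then obtain i where i: "f = F i" "i \<in> {1..r}" by blast
          have \<Phi>: "F i * \<Phi> a = \<Phi> (a(i := Suc (a i)))"
          proof -
            have "\<Phi> (a(i := Suc (a i))) = F i ^ Suc (a i) * (\<Prod>l\<in>{1..r} - {i}. F l ^ a l)"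
              unfolding \<Phi>_def using i(2) by (subst prod.remove[of _ i]) auto
            moreover have "\<Phi> a = F i ^ a i * (\<Prod>l\<in>{1..r} - {i}. F l ^ a l)"
              unfolding \<Phi>_def using i(2) by (subst prod.remove[of _ i]) auto
            ultimately show ?thesis by (simp add: mult.assoc)
          qed
          have "(\<Sum>l\<in>{1..r}. (a(i := Suc (a i))) l) = Suc (\<Sum>l\<in>{1..r}. a l)"
            using i(2) by (simp add: sum.remove[of _ i])
          then have "c * \<Phi> (a(i := Suc (a i))) \<in> ?W"
            using False by (intro less.hyps) simp
          then have "c * f \<in> X" by (simp add: X_def i(1) \<Phi> mult.assoc)
          then show ?case using step(2) by (intro mpol.subspace_add[OF X])
        qed
      qed
      ultimately have "mpol.span (B \<union> ?I) \<subseteq> X" using X by (intro mpol.span_minimal) auto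
      then have low: "deg_le n \<subseteq> X" using B(3) by blast
      have mon: "mon m \<in> X" for m
      proof (cases "mdeg m \<le> n")
        case True
        then show ?thesis using low by (auto simp: supp_space_def)
      next
        case False
        then have "mon m \<in> (deg_ge n :: ('v, 'k) mpol set)" by (simp add: supp_space_def)
        then show ?thesis
          unfolding X_def by (intro CollectI high ideal_mult_right[OF ideal_deg_ge])
      qed
      have "h \<in> mpol.span X" by (rule mpol_in_span_mon) (rule mpol.span_base[OF mon])
      moreover have "mpol.span X = X" using X by (simp only: mpol.span_eq_iff)
      ultimately have "h \<in> X" by simp
      then show ?thesis by (simp add: X_def)
    qed
  qed
  define A where "A = (UNIV :: 'v set) \<rightarrow>\<^sub>E {..<q}"
  have A: "finite A" "card A = q ^ ?N"
    using fin by (auto simp: A_def finite_PiE card_PiE)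
  define \<mu> where "\<mu> a = (mon (Abs_poly_mapping a) :: ('v, 'k) mpol)" for a
  have "\<mu> a \<in> ?W" for a
    using all[of "\<mu> a" "\<lambda>_. 0"] by (simp add: \<Phi>_def)
  moreover have "card T < card A"
  proof -
    have "n + 1 \<le> (?N + 1) * q" by (simp add: n_def q_def)
    have "card T \<le> K * (n + 1) ^ d * (n + 1) ^ r"
      by (rule order.trans[OF T(2)]) (auto intro!: mult_left_mono power_mono)
    also have "\<dots> = K * (n + 1) ^ (d + r)" by (simp add: power_add)
    also have "\<dots> \<le> K * ((?N + 1) * q) ^ (d + r)"
      using \<open>n + 1 \<le> (?N + 1) * q\<close> by (intro mult_left_mono power_mono) auto
    also have "\<dots> = (K * (?N + 1) ^ (d + r)) * q ^ (d + r)"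
      by (simp only: power_mult_distrib mult_ac)
    also have "\<dots> < q * q ^ (d + r)"
      by (intro mult_strict_right_mono) (auto simp: q_def)
    also have "\<dots> \<le> q ^ ?N"
      using \<open>\<not> ?N \<le> d + r\<close> power_increasing[of "Suc (d + r)" ?N q] by (simp add: q_def)
    finally show ?thesis using A(2) by simp
  qed
  ultimately obtain c where c: "\<exists>a\<in>A. c a \<noteq> 0" "(\<Sum>a\<in>A. smul (c a) (\<mu> a)) \<in> deg_ge n"
    using mpol.nontrivial_relation_modulo_subspace
      [where W = "deg_ge n" and f = \<mu>, OF T(1) subspace_supp_space A(1)]
    by blast
  then obtain a where a: "a \<in> A" "c a \<noteq> 0" by blast
  have "Poly_Mapping.lookup (\<Sum>a\<in>A. smul (c a) (\<mu> a)) (Abs_poly_mapping a)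
      = (\<Sum>b\<in>A. if b = a then c b else 0)"
  proof -
    have "Abs_poly_mapping b = Abs_poly_mapping a \<longleftrightarrow> b = a" for a b :: "'v \<Rightarrow> nat"
      using lookup_Abs_finite[OF fin] by metis
    then show ?thesis
      by (simp add: lookup_sum \<mu>_def lookup_mon if_distrib[of "\<lambda>x. _ * x"] cong: if_cong)
  qed
  also have "\<dots> = c a" using A(1) a(1) by simp
  finally have "Abs_poly_mapping a \<in> Poly_Mapping.keys (\<Sum>a\<in>A. smul (c a) (\<mu> a))"
    using a(2) by (simp add: in_keys_iff)
  then have "n \<le> mdeg (Abs_poly_mapping a)" using c(2) by (auto simp: supp_space_def)
  also have "\<dots> = (\<Sum>v\<in>UNIV. a v)" by (simp add: mdeg_def lookup_Abs_finite[OF fin])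
  also have "\<dots> \<le> (\<Sum>v\<in>(UNIV :: 'v set). q - 1)"
  proof (rule sum_mono)
    fix v
    have "a v < q" using a(1) by (auto simp: A_def PiE_iff)
    then show "a v \<le> q - 1" by simp
  qed
  also have "\<dots> < n" using \<open>0 < n\<close> by (simp add: n_def)
  finally show False by simp
qed

section \<open>Staircase ideals\<close>

text \<open>The ideals \<open>J\<^bsub>2,t\<^esub>\<close> in a uniform notation: \<open>U\<close> lists \<open>x\<^sub>1, x\<^sub>2, y\<^sub>0, \<dots>, y\<^bsub>t-2\<^esub>\<close>, so that the monomial
generators are exactly the products \<open>U\<^sub>i Z\<^sub>j\<close> with \<open>i \<le> j\<close> and \<open>1 \<le> j \<le> t\<close>; \<open>a\<close> and \<open>b\<close> are \<open>x\<^sub>3\<close> and \<open>x\<^sub>4\<close>.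
The assumptions record which indeterminates stay different under every admissible identification.
In particular \<open>b\<close> may be one of the \<open>U\<^sub>i\<close>, and \<open>Z\<^sub>i\<close> may be \<open>U\<^sub>j\<close> for \<open>i < j\<close>.\<close>

locale staircase =
  fixes U Z :: "nat \<Rightarrow> 'v" and a b :: 'v and t :: nat
  assumes fin: "finite (UNIV :: 'v set)"
    and t_pos: "1 \<le> t"
    and inj_U: "inj_on U {..t}"
    and inj_Z: "inj_on Z {1..t}"
    and U_neq_Z: "i \<le> j \<Longrightarrow> 1 \<le> j \<Longrightarrow> j \<le> t \<Longrightarrow> U i \<noteq> Z j"
    and distinct_x: "distinct [U 0, U 1, a, b]"
    and ab_not_Z: "{a, b} \<inter> Z ` {1..t} = {}"
begin

text \<open>The quadratic monomials \<open>x\<^sub>2 x\<^sub>3\<close> and \<open>U\<^sub>i Z\<^sub>j\<close> as edges of a graph on the indeterminates.  They are the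
leading monomials of the generators in a term order with \<open>x\<^sub>2 x\<^sub>3 > x\<^sub>1 x\<^sub>4\<close>.\<close>

definition edges :: "('v \<times> 'v) set" where
  "edges = insert (U 1, a) {(U i, Z j) | i j. i \<le> j \<and> 1 \<le> j \<and> j \<le> t}"

definition minor :: "('v, 'k::field) mpol" where
  "minor = var (U 0) * var b - var (U 1) * var a"

definition gens :: "('v, 'k::field) mpol set" where
  "gens = insert minor {var (U i) * var (Z j) | i j. i \<le> j \<and> 1 \<le> j \<and> j \<le> t}"

text \<open>The monomials divisible by none of the \<open>k\<close>-th powers \<open>(u v) ^ k\<close> for edges \<open>(u, v)\<close>.  The case \<open>k = 1\<close>
serves for \<open>J\<close> itself, larger \<open>k\<close> for ideals that contain only powers of the generators.\<close>

definition standard :: "nat \<Rightarrow> ('v \<Rightarrow>\<^sub>0 nat) \<Rightarrow> bool" where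
  "standard k m \<longleftrightarrow> (\<forall>(u, v)\<in>edges. Poly_Mapping.lookup m u < k \<or> Poly_Mapping.lookup m v < k)"

lemma edge_neq: "(u, v) \<in> edges \<Longrightarrow> u \<noteq> v"
  using U_neq_Z distinct_x by (auto simp: edges_def)

text \<open>If \<open>k\<close> is the largest index with
\<open>Z\<^sub>k \<in> S\<close>, then \<open>U\<^sub>0, \<dots>, U\<^sub>k\<close> and \<open>Z\<^bsub>k+1\<^esub>, \<dots>, Z\<^sub>t\<close> are missing, and these are \<open>t + 1\<close> different
indeterminates.  If no \<open>Z\<^sub>j\<close> is in \<open>S\<close>, the edge between \<open>x\<^sub>2\<close> and \<open>x\<^sub>3\<close> supplies the last missing one.\<close>

lemma independent_misses:
  assumes "\<And>u v. (u, v) \<in> edges \<Longrightarrow> u \<notin> S \<or> v \<notin> S"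
  shows "t + 1 \<le> card (- S)"
proof -
  have finS: "finite (- S)" using fin by (rule rev_finite_subset) simp
  let ?J = "{j \<in> {1..t}. Z j \<in> S}"
  show ?thesis
  proof (cases "?J = {}")
    case True
    obtain x where x: "x \<in> {U 1, a}" "x \<notin> S"
      using assms[of "U 1" a] by (auto simp: edges_def)
    have "x \<notin> Z ` {1..t}" using x(1) U_neq_Z[of 1] ab_not_Z by fastforce
    then have "card (insert x (Z ` {1..t})) = t + 1"
      using inj_Z by (simp add: card_image)
    moreover have "insert x (Z ` {1..t}) \<subseteq> - S" using True x by auto
    ultimately show ?thesis using card_mono[OF finS] by metis
  next
    case False
    define k where "k = Max ?J"
    have "k \<in> ?J" unfolding k_def using False by (intro Max_in) auto
    then have k: "1 \<le> k" "k \<le> t" "Z k \<in> S" by auto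
    have "Z j \<notin> S" if "j \<in> {k + 1..t}" for j
    proof
      assume "Z j \<in> S"
      then have "j \<le> k" unfolding k_def using that by (intro Max_ge) auto
      then show False using that by simp
    qed
    moreover have "U i \<notin> S" if "i \<le> k" for i
      using assms[of "U i" "Z k"] k that by (auto simp: edges_def)
    ultimately have "U ` {..k} \<union> Z ` {k + 1..t} \<subseteq> - S" by auto
    moreover have "card (U ` {..k} \<union> Z ` {k + 1..t}) = t + 1"
    proof -
      have "U ` {..k} \<inter> Z ` {k + 1..t} = {}" using U_neq_Z by fastforce
      moreover have "card (U ` {..k}) = k + 1"
        using inj_on_subset[OF inj_U, of "{..k}"] k by (simp add: card_image)
      moreover have "card (Z ` {k + 1..t}) = t - k"
        using inj_on_subset[OF inj_Z, of "{k + 1..t}"] k by (simp add: card_image)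
      ultimately show ?thesis using k by (simp add: card_Un_disjoint)
    qed
    ultimately show ?thesis using card_mono[OF finS] by metis
  qed
qed

lemma independent_card:
  assumes "\<And>u v. (u, v) \<in> edges \<Longrightarrow> u \<notin> S \<or> v \<notin> S"
  shows "card S + (t + 1) \<le> card (UNIV :: 'v set)"
proof -
  have "card (- S) = card (UNIV :: 'v set) - card S"
    using fin by (metis Compl_eq_Diff_UNIV card_Diff_subset finite_subset subset_UNIV)
  moreover have "card S \<le> card (UNIV :: 'v set)" using fin by (intro card_mono) auto
  ultimately show ?thesis using independent_misses[OF assms] by linarith
qed

text \<open>A monomial divisible by \<open>(U\<^sub>i Z\<^sub>j) ^ k\<close> lies in the ideal.  One divisible by \<open>(x\<^sub>2 x\<^sub>3) ^ k\<close> is rewritten by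
expanding \<open>(x\<^sub>1 x\<^sub>4 - x\<^sub>2 x\<^sub>3) ^ k\<close>, which lowers the exponent of \<open>x\<^sub>2\<close> and keeps the degree.\<close>

lemma mon_in_span_standard:
  fixes I :: "('v, 'k::field) mpol set"
  assumes I: "ideal.subspace I" and gens: "\<And>g. g \<in> gens \<Longrightarrow> g ^ k \<in> I"
  shows "mon m \<in> mpol.span (mon ` {n. standard k n \<and> mdeg n = mdeg m} \<union> I)"
proof (induction "Poly_Mapping.lookup m (U 1)" arbitrary: m rule: less_induct)
  case less
  let ?W = "mpol.span (mon ` {n. standard k n \<and> mdeg n = mdeg m} \<union> I)"
  show ?case
  proof (cases "standard k m")
    case True
    then show ?thesis by (intro mpol.span_base) auto
  next
    case False
    then obtain u v where uv: "(u, v) \<in> edges" "k \<le> Poly_Mapping.lookup m u" "k \<le> Poly_Mapping.lookup m v"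
      by (force simp: standard_def)
    define s where "s = Poly_Mapping.single u k + Poly_Mapping.single v k"
    define r where "r = m - s"
    have m: "m = s + r"
    proof (rule poly_mapping_eqI)
      fix x
      have "Poly_Mapping.lookup s x \<le> Poly_Mapping.lookup m x"
        using uv edge_neq[OF uv(1)] by (auto simp: s_def lookup_add lookup_single when_def)
      then show "Poly_Mapping.lookup m x = Poly_Mapping.lookup (s + r) x"
        by (simp add: r_def lookup_add lookup_minus)
    qed
    have s: "mon s = (var u * var v :: ('v, 'k) mpol) ^ k"
      by (simp add: s_def mon_add power_mult_distrib var_power)
    show ?thesis
    proof (cases "(u, v) = (U 1, a)")
      case False
      then have "var u * var v \<in> (gens :: ('v, 'k) mpol set)"
        using uv(1) by (auto simp: edges_def gens_def)
      then have "mon m \<in> I"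
        unfolding m mon_add s using ideal_mult_right[OF I gens] by blast
      then show ?thesis by (intro mpol.span_base) auto
    next
      case True
      define A B where "A = (var (U 0) * var b :: ('v, 'k) mpol)"
        and "B = (var (U 1) * var a :: ('v, 'k) mpol)"
      define T where "T i = of_nat (k choose i) * (- B) ^ i * A ^ (k - i)" for i
      have "A - B \<in> gens" by (simp add: gens_def minor_def A_def B_def)
      then have D: "(A - B) ^ k * mon r \<in> I" by (intro ideal_mult_right[OF I] gens)
      have exp: "(A - B) ^ k = (\<Sum>i<k. T i) + (- 1) ^ k * B ^ k"
        using binomial_ring[of "- B" A k]
        by (simp add: T_def lessThan_Suc_atMost[symmetric] flip: power_minus)
      have "T i * mon r \<in> ?W" if i: "i < k" for i
      proof -
        define n where "n = Poly_Mapping.single (U 1) i + Poly_Mapping.single a i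
          + Poly_Mapping.single (U 0) (k - i) + Poly_Mapping.single b (k - i) + r"
        have n: "B ^ i * A ^ (k - i) * mon r = mon n"
          by (simp add: n_def A_def B_def mon_add power_mult_distrib var_power mult_ac)
        have lower: "Poly_Mapping.lookup n (U 1) < Poly_Mapping.lookup m (U 1)"
          using i distinct_x True unfolding m n_def s_def
          by (auto simp: lookup_add lookup_single when_def)
        have deg: "mdeg n = mdeg m"
          using i unfolding m n_def s_def by (simp add: mdeg_single[OF fin])
        have "mon n \<in> ?W" using less[OF lower] unfolding deg .
        moreover have "T i * mon r = smul (of_nat (k choose i) * (- 1) ^ i) (mon n)"
        proof -
          have "Poly_Mapping.single 0 (of_nat (k choose i) * (- 1 :: 'k) ^ i)
              = (of_nat (k choose i) * (- 1) ^ i :: ('v, 'k) mpol)"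
            by (cases "even i") (simp_all add: single_uminus)
          then show ?thesis
            unfolding smul_def T_def n[symmetric] power_minus[of B] by (simp only: mult_ac)
        qed
        ultimately show ?thesis by (simp add: mpol.span_scale)
      qed
      then have "(\<Sum>i<k. T i * mon r) \<in> ?W" by (intro mpol.span_sum) auto
      moreover have "(A - B) ^ k * mon r \<in> ?W" using D by (intro mpol.span_base) auto
      ultimately have "(A - B) ^ k * mon r - (\<Sum>i<k. T i * mon r) \<in> ?W"
        by (rule mpol.span_diff[rotated])
      also have "(A - B) ^ k * mon r - (\<Sum>i<k. T i * mon r) = (- 1) ^ k * mon m"
        unfolding exp m mon_add s using True
        by (simp add: B_def distrib_right sum_distrib_right mult.assoc)
      finally have *: "(- 1) ^ k * mon m \<in> ?W" .
      show ?thesis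
      proof (cases "even k")
        case False
        then show ?thesis using mpol.span_neg[OF *] by simp
      qed (use * in simp)
    qed
  qed
qed

lemma span_standard:
  fixes I :: "('v, 'k::field) mpol set"
  assumes "ideal.subspace I" "\<And>g. g \<in> gens \<Longrightarrow> g ^ k \<in> I"
  shows "f \<in> mpol.span (mon ` {n. standard k n} \<union> I)"
  by (rule mpol_in_span_mon) (rule subsetD[OF mpol.span_mono mon_in_span_standard[OF assms]], auto)

text \<open>The positions of exponents at least \<open>k\<close> in a standard monomial form an independent set, so there are
at most \<open>N - (t + 1)\<close> of them.\<close>

lemma growth:
  fixes I :: "('v, 'k::field) mpol set"
  assumes I: "ideal.subspace I" "\<And>g. g \<in> gens \<Longrightarrow> g ^ k \<in> I" and "1 \<le> k"
  shows "\<exists>B. finite B \<and> card B \<le> (2 ^ card (UNIV :: 'v set) * k ^ card (UNIV :: 'v set))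
      * (D + 1) ^ (card (UNIV :: 'v set) - (t + 1)) \<and> deg_le D \<subseteq> mpol.span (B \<union> I)"
proof -
  define d where "d = card (UNIV :: 'v set) - (t + 1)"
  define M where "M = {m :: 'v \<Rightarrow>\<^sub>0 nat. (\<forall>v. Poly_Mapping.lookup m v \<le> D) \<and>
     card {v. k \<le> Poly_Mapping.lookup m v} \<le> d}"
  note M = card_few_large_exponents[OF fin \<open>1 \<le> k\<close>, of D d, folded M_def]
  have sub: "{n. standard k n \<and> mdeg n = mdeg m} \<subseteq> M" if "mdeg m \<le> D" for m
  proof
    fix n assume n: "n \<in> {n. standard k n \<and> mdeg n = mdeg m}"
    then have "card {v. k \<le> Poly_Mapping.lookup n v} + (t + 1) \<le> card (UNIV :: 'v set)"
      by (intro independent_card) (force simp: standard_def)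
    moreover have "Poly_Mapping.lookup n v \<le> D" for v
      using lookup_le_mdeg[OF fin, of n v] n that by simp
    ultimately show "n \<in> M" by (auto simp: M_def d_def)
  qed
  have "deg_le D \<subseteq> mpol.span (mon ` M \<union> I)"
  proof
    fix f :: "('v, 'k) mpol" assume f: "f \<in> deg_le D"
    show "f \<in> mpol.span (mon ` M \<union> I)"
    proof (rule mpol_in_span_mon)
      fix m assume "m \<in> Poly_Mapping.keys f"
      then have "mdeg m \<le> D" using f by (auto simp: supp_space_def)
      from sub[OF this] have "mon ` {n. standard k n \<and> mdeg n = mdeg m} \<union> I \<subseteq> mon ` M \<union> I"
        by blast
      then show "mon m \<in> mpol.span (mon ` M \<union> I)"
        using mon_in_span_standard[OF I] mpol.span_mono by blast
    qed
  qed
  moreover have "card (mon ` M :: ('v, 'k) mpol set) \<le> card M" using M(1) by (rule card_image_le)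
  ultimately show ?thesis
    using M unfolding d_def by (intro exI[of _ "mon ` M"]) auto
qed

abbreviation J :: "('v, 'k::field) mpol set" where
  "J \<equiv> ideal_gen gens"

lemma ideal_J: "ideal.subspace J"
  by (simp add: ideal_gen_def)

lemma gens_subset_J: "g \<in> gens \<Longrightarrow> g \<in> J"
  by (simp add: ideal_gen_def ideal.span_base)

lemma variety_J_iff:
  "p \<in> variety (J :: ('v, 'k::field) mpol set) \<longleftrightarrow>
    p (U 0) * p b = p (U 1) * p a \<and> (\<forall>i j. i \<le> j \<and> 1 \<le> j \<and> j \<le> t \<longrightarrow> p (U i) * p (Z j) = 0)"
proof -
  have "p \<in> variety gens \<longleftrightarrow> eval_mpol p minor = 0 \<and>
      (\<forall>i j. i \<le> j \<and> 1 \<le> j \<and> j \<le> t \<longrightarrow> eval_mpol p (var (U i) * var (Z j) :: ('v, 'k) mpol) = 0)"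
    unfolding variety_def gens_def by blast
  then show ?thesis
    unfolding variety_ideal_gen minor_def eval_diff eval_mult eval_var by simp
qed

lemma dim_le:
  "variety_dim (variety (J :: ('v, 'k::field) mpol set)) \<le> enat (card (UNIV :: 'v set) - (t + 1))"
  unfolding variety_dim_def
proof (intro SUP_least)
  fix n
  assume "n \<in> {n. \<exists>C. (\<forall>i\<le>n. irreducible_closed (C i) \<and> C i \<subseteq> variety (J :: ('v, 'k) mpol set)) \<and>
     (\<forall>i<n. C i \<subset> C (Suc i))}"
  then obtain C where C: "\<forall>i\<le>n. irreducible_closed (C i) \<and> C i \<subseteq> variety (J :: ('v, 'k) mpol set)"
    "\<forall>i<n. C i \<subset> C (Suc i)" by blast
  have "n \<le> card (UNIV :: 'v set) - (t + 1)"
  proof (rule chain_length_le_growth[where C = C and V = "variety J" and I = "J :: ('v, 'k) mpol set"])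
    show "\<exists>B. finite B \<and> card B \<le> (2 ^ card (UNIV :: 'v set) * 1 ^ card (UNIV :: 'v set))
      * (D + 1) ^ (card (UNIV :: 'v set) - (t + 1)) \<and> deg_le D \<subseteq> mpol.span (B \<union> (J :: ('v, 'k) mpol set))" for D
      by (rule growth) (auto simp: ideal_J gens_subset_J)
  qed (use C ideal_imp_subspace[OF ideal_J] in \<open>auto simp: variety_def\<close>)
  then show "enat n \<le> enat (card (UNIV :: 'v set) - (t + 1))" by simp
qed

text \<open>The coordinate subspace \<open>x\<^sub>1 = x\<^sub>2 = z\<^sub>2 = \<dots> = z\<^sub>t = 0\<close> is one of the components.\<close>

lemma dim_ge:
  assumes "infinite (UNIV :: 'k::field set)"
  shows "enat (card (UNIV :: 'v set) - (t + 1)) \<le> variety_dim (variety (J :: ('v, 'k) mpol set))"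
proof -
  define S where "S = - insert (U 0) (insert (U 1) (Z ` {2..t}))"
  have "card (insert (U 0) (insert (U 1) (Z ` {2..t}))) = t + 1"
  proof -
    have "card (Z ` {2..t}) = t - 1"
      using inj_on_subset[OF inj_Z, of "{2..t}"] by (subst card_image) auto
    moreover have "U 0 \<notin> Z ` {2..t}" "U 1 \<notin> Z ` {2..t}"
      using U_neq_Z[of 0] U_neq_Z[of 1] by (auto simp: image_iff)
    ultimately show ?thesis using distinct_x t_pos by simp
  qed
  then have card: "card S = card (UNIV :: 'v set) - (t + 1)"
    unfolding S_def Compl_eq_Diff_UNIV by (subst card_Diff_subset) auto
  have "coordinate_space S \<subseteq> variety (J :: ('v, 'k) mpol set)"
  proof
    fix p :: "'v \<Rightarrow> 'k" assume p: "p \<in> coordinate_space S"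
    then have p0: "p (U 0) = 0" "p (U 1) = 0" by (auto simp: coordinate_space_def S_def)
    have "p (U i) * p (Z j) = 0" if "i \<le> j" "1 \<le> j" "j \<le> t" for i j
    proof (cases "j = 1")
      case True
      then have "i = 0 \<or> i = 1" using that by auto
      then show ?thesis using p0 by auto
    next
      case False
      then have "p (Z j) = 0" using p that by (auto simp: coordinate_space_def S_def)
      then show ?thesis by simp
    qed
    then show "p \<in> variety J" using p0 by (auto simp: variety_J_iff)
  qed
  from coordinate_space_chain[OF assms fin this]
  have "card S \<in> {n. \<exists>C. (\<forall>i\<le>n. irreducible_closed (C i) \<and> C i \<subseteq> variety (J :: ('v, 'k) mpol set)) \<and>
     (\<forall>i<n. C i \<subset> C (Suc i))}" by blast
  then show ?thesis
    unfolding variety_dim_def card[symmetric] by (rule SUP_upper)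
qed

text \<open>A polynomial \<open>f\<close> in the radical vanishes on the variety, and so does the combination \<open>g\<close> of standard
monomials congruent to it; it remains to see that \<open>g\<close> has no monomial \<open>m\<close>.  The support of \<open>m\<close> is
independent.  If it contains neither \<open>x\<^sub>1\<close> nor \<open>x\<^sub>2\<close>, the coordinate subspace of the support lies in
the variety, and the restriction of \<open>g\<close> to it retains \<open>m\<close>.  Otherwise it contains no \<open>Z\<^sub>j\<close>, and \<open>g\<close> is
restricted to the component where the \<open>Z\<^sub>j\<close> and the minor vanish, which is parametrized by
\<open>x\<^sub>3 = x\<^sub>1 s\<close>, \<open>x\<^sub>4 = x\<^sub>2 s\<close>.  This substitution maps different standard monomials to different
monomials because a standard monomial is not divisible by \<open>x\<^sub>2 x\<^sub>3\<close>.\<close>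

lemma radical_J:
  assumes inf: "infinite (UNIV :: 'k::field set)"
  shows "radical J \<subseteq> (J :: ('v, 'k) mpol set)"
proof
  fix f :: "('v, 'k) mpol" assume "f \<in> radical J"
  then obtain n where n: "f ^ n \<in> J" by (auto simp: radical_def)
  have f0: "eval_mpol p f = 0" if "p \<in> variety J" for p :: "'v \<Rightarrow> 'k"
  proof -
    have "eval_mpol p (f ^ n) = 0" using that n by (auto simp: variety_def)
    then show ?thesis by (auto simp: eval_power)
  qed
  have "f \<in> mpol.span (mon ` {n. standard 1 n} \<union> J)"
    by (rule span_standard) (auto simp: ideal_J gens_subset_J)
  then obtain g h where gh: "f = g + h" "g \<in> mpol.span (mon ` {n. standard 1 n})" "h \<in> mpol.span J"
    unfolding mpol.span_Un by blast
  have "mpol.span J = (J :: ('v, 'k) mpol set)"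
    using ideal_imp_subspace[OF ideal_J] by (simp only: mpol.span_eq_iff)
  then have hJ: "h \<in> J" using gh(3) by (simp only:)
  have g0: "eval_mpol p g = 0" if "p \<in> variety J" for p :: "'v \<Rightarrow> 'k"
    using f0[OF that] that gh(1) hJ by (auto simp: eval_add variety_def)
  have std: "standard 1 m" if "m \<in> Poly_Mapping.keys g" for m
    using gh(2) span_mon_subset that by (fastforce simp: supp_space_def)
  have indep: "u \<notin> Poly_Mapping.keys m \<or> v \<notin> Poly_Mapping.keys m"
    if "m \<in> Poly_Mapping.keys g" "(u, v) \<in> edges" for m u v
    using std[OF that(1)] that(2) by (force simp: standard_def in_keys_iff)
  have "m \<notin> Poly_Mapping.keys g" for m
  proof
    assume m: "m \<in> Poly_Mapping.keys g"
    show False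
    proof (cases "U 0 \<in> Poly_Mapping.keys m \<or> U 1 \<in> Poly_Mapping.keys m")
      case False
      define S where "S = Poly_Mapping.keys m"
      obtain w :: "'v \<Rightarrow> nat" where w: "inj_on (weight w) (Poly_Mapping.keys g)"
        using injective_weight[OF fin finite_keys] by blast
      have "curve w S \<tau> \<in> variety (J :: ('v, 'k) mpol set)" for \<tau>
      proof -
        have zero: "curve w S \<tau> v = 0" if "v \<notin> Poly_Mapping.keys m" for v
          using that by (simp add: curve_def S_def)
        have "curve w S \<tau> (U i) * curve w S \<tau> (Z j) = 0" if "i \<le> j \<and> 1 \<le> j \<and> j \<le> t" for i j
        proof -
          have "(U i, Z j) \<in> edges" using that by (auto simp: edges_def)
          from indep[OF m this] show ?thesis using zero by auto
        qed
        then show ?thesis using False zero by (simp add: variety_J_iff)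
      qed
      then have "\<not> Poly_Mapping.keys m \<subseteq> S"
        using g0 by (intro vanishing_on_curve[OF inf fin inj_on_subset[OF w] _ m]) auto
      then show False by (simp add: S_def)
    next
      case True
      define S where "S = - Z ` {1..t}"
      have mS: "Poly_Mapping.keys m \<subseteq> S"
      proof
        fix v assume v: "v \<in> Poly_Mapping.keys m"
        have False if "v = Z j" "j \<in> {1..t}" for j
          using True indep[OF m, of "U 0" "Z j"] indep[OF m, of "U 1" "Z j"] v that
          by (auto simp: edges_def)
        then show "v \<in> S" unfolding S_def by blast
      qed
      \<comment> \<open>The exponents after the substitution \<open>a = U\<^sub>0 s\<close>, \<open>b = U\<^sub>1 s\<close>, with the place of \<open>a\<close> reused for \<open>s\<close>.\<close>
      define tw where "tw n = (Poly_Mapping.lookup n)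
        (U 0 := Poly_Mapping.lookup n (U 0) + Poly_Mapping.lookup n a,
         U 1 := Poly_Mapping.lookup n (U 1) + Poly_Mapping.lookup n b,
         a := Poly_Mapping.lookup n a + Poly_Mapping.lookup n b, b := 0)" for n :: "'v \<Rightarrow>\<^sub>0 nat"
      obtain w :: "'v \<Rightarrow> nat" where w: "\<forall>x\<in>tw ` Poly_Mapping.keys g. \<forall>y\<in>tw ` Poly_Mapping.keys g.
          (\<Sum>v\<in>UNIV. w v * x v) = (\<Sum>v\<in>UNIV. w v * y v) \<longrightarrow> (\<forall>v\<in>UNIV. x v = y v)"
        using separating_weights[OF fin finite_imageI[OF finite_keys[of g]], of tw] by blast
      define w' where "w' = w(a := w (U 0) + w a, b := w (U 1) + w a)"
      have w': "weight w' n = (\<Sum>v\<in>UNIV. w v * tw n v)" for n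
      proof -
        let ?X = "{U 0, U 1, a, b}"
        have split: "(\<Sum>v\<in>UNIV. h v) = (\<Sum>v\<in>UNIV - ?X. h v) + (h (U 0) + h (U 1) + h a + h b)"
          for h :: "'v \<Rightarrow> nat"
          using sum.subset_diff[of ?X UNIV h] fin distinct_x by simp
        have "(\<Sum>v\<in>UNIV - ?X. w' v * Poly_Mapping.lookup n v) = (\<Sum>v\<in>UNIV - ?X. w v * tw n v)"
          by (rule sum.cong) (auto simp: w'_def tw_def)
        then show ?thesis
          unfolding weight_def split using distinct_x by (simp add: w'_def tw_def algebra_simps)
      qed
      have inj: "inj_on (weight w') (Poly_Mapping.keys g)"
      proof (rule inj_onI)
        fix m n assume mn: "m \<in> Poly_Mapping.keys g" "n \<in> Poly_Mapping.keys g"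
          and "weight w' m = weight w' n"
        with bspec[OF bspec[OF w imageI[OF mn(1)]] imageI[OF mn(2)]]
        have tw: "tw m v = tw n v" for v unfolding w' by blast
        have "Poly_Mapping.lookup x (U 1) = 0 \<or> Poly_Mapping.lookup x a = 0"
          if "x \<in> Poly_Mapping.keys g" for x
          using std[OF that] by (auto simp: standard_def edges_def)
        from this[OF mn(1)] this[OF mn(2)] tw[of "U 0"] tw[of "U 1"] tw[of a]
        have eq: "Poly_Mapping.lookup m v = Poly_Mapping.lookup n v" if "v \<in> {U 0, U 1, a, b}" for v
          using that distinct_x by (auto simp: tw_def)
        show "m = n"
        proof (rule poly_mapping_eqI)
          fix v
          show "Poly_Mapping.lookup m v = Poly_Mapping.lookup n v"
            using eq[of v] tw[of v] by (cases "v \<in> {U 0, U 1, a, b}") (auto simp: tw_def)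
        qed
      qed
      have "curve w' S \<tau> \<in> variety (J :: ('v, 'k) mpol set)" for \<tau>
      proof -
        have "U 0 \<in> S" "U 1 \<in> S" "a \<in> S" "b \<in> S"
          using U_neq_Z[of 0] U_neq_Z[of 1] ab_not_Z by (auto simp: S_def image_iff)
        moreover have "w' (U 0) + w' b = w' (U 1) + w' a"
          using distinct_x by (simp add: w'_def)
        ultimately show ?thesis
          unfolding variety_J_iff by (auto simp: curve_def S_def simp flip: power_add)
      qed
      then have "\<not> Poly_Mapping.keys m \<subseteq> S"
        using g0 by (intro vanishing_on_curve[OF inf fin inj_on_subset[OF inj] _ m]) auto
      then show False using mS by blast
    qed
  qed
  then have "g = 0" by (intro poly_mapping_eqI) (simp add: in_keys_iff)
  then show "f \<in> J" using gh(1) hJ by simp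
qed

lemma finite_gens: "finite gens"
proof -
  have "gens \<subseteq> insert minor ((\<lambda>(i, j). var (U i) * var (Z j)) ` ({..t} \<times> {..t}))"
    by (force simp: gens_def)
  then show ?thesis by (rule finite_subset) auto
qed

lemma gens_deg_ge: "g \<in> gens \<Longrightarrow> g \<in> deg_ge 1"
proof -
  have "var v \<in> (deg_ge 1 :: ('v, 'k::field) mpol set)" for v
    by (simp add: supp_space_def var_eq_mon mdeg_single[OF fin])
  then have "var u * var v \<in> (deg_ge 1 :: ('v, 'k::field) mpol set)" for u v
    by (intro ideal_mult_right[OF ideal_deg_ge])
  then show "g \<in> gens \<Longrightarrow> g \<in> deg_ge 1" for g :: "('v, 'k::field) mpol"
    by (auto simp: gens_def minor_def intro: ideal.subspace_diff[OF ideal_deg_ge])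
qed

text \<open>If \<open>J\<close> is the radical of \<open>(F\<^sub>1, \<dots>, F\<^sub>r)\<close>, a common power of the generators lies in that ideal, so its
growth is of order at most \<open>N - (t + 1)\<close>; and the \<open>F\<^sub>i\<close>, being in \<open>J\<close>, have no constant term.\<close>

lemma ara_lower:
  fixes F :: "nat \<Rightarrow> ('v, 'k::field) mpol"
  assumes J: "J = radical (ideal_gen (F ` {1..r}))"
  shows "t + 1 \<le> r"
proof -
  let ?I = "ideal_gen (F ` {1..r})"
  have I: "ideal.subspace ?I" by (simp add: ideal_gen_def)
  have "\<exists>k. g ^ k \<in> ?I" if "g \<in> gens" for g
    using gens_subset_J[OF that] by (auto simp: J radical_def)
  then obtain e where e: "\<And>g. g \<in> gens \<Longrightarrow> g ^ e g \<in> ?I" by metis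
  define k where "k = Suc (\<Sum>g\<in>gens. e g)"
  have k: "g ^ k \<in> ?I" if "g \<in> gens" for g
    using member_le_sum[OF that _ finite_gens, of e]
    by (intro ideal_power_ge[OF I e[OF that]]) (simp add: k_def)
  have "F i \<in> deg_ge 1" if "i \<in> {1..r}" for i
  proof -
    have "F i \<in> ?I" using that by (auto simp: ideal_gen_def intro: ideal.span_base)
    then have "F i \<in> J" using radical_superset unfolding J by blast
    moreover have "J \<subseteq> (deg_ge 1 :: ('v, 'k) mpol set)"
      unfolding ideal_gen_def using gens_deg_ge by (intro ideal.span_minimal ideal_deg_ge) blast
    ultimately show ?thesis by blast
  qed
  from number_of_equations_growth[OF fin this growth[OF I k]]
  have "card (UNIV :: 'v set) \<le> card (UNIV :: 'v set) - (t + 1) + r" by (simp add: k_def)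
  moreover have "t + 1 \<le> card (UNIV :: 'v set)" using independent_card[of "{}"] by simp
  ultimately show ?thesis by linarith
qed

text \<open>The abstract equations apply because the minor lies in the ideal generated by \<open>x\<^sub>1\<close> and \<open>x\<^sub>2\<close>, the first
two of the \<open>U\<^sub>i\<close>; the ideal they generate up to radical is \<open>J\<close> since \<open>J\<close> is radical.\<close>

lemma ara_upper:
  assumes "infinite (UNIV :: 'k::field set)"
  shows "\<exists>F. J = radical (ideal_gen (F ` {1..t + 1}) :: ('v, 'k) mpol set)"
proof -
  define z where "z j = (if 1 \<le> j \<and> j \<le> t then var (Z j) else 0 :: ('v, 'k) mpol)" for j
  let ?G = "insert minor {var (U i) * z j | i j. i \<le> j \<and> j \<le> t}"
  have "minor = var b * var (U 0) + (- var a) * (var (U 1) :: ('v, 'k) mpol)"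
    by (simp add: minor_def mult.commute)
  then obtain F where F: "F ` {1..t + 1} \<subseteq> ideal_gen ?G" "?G \<subseteq> radical (ideal_gen (F ` {1..t + 1}))"
    using staircase_radical_generators[OF t_pos, of z minor "var b" "\<lambda>i. var (U i)" "- var a"]
    by (auto simp: z_def)
  let ?I = "ideal_gen (F ` {1..t + 1})"
  have I: "ideal.subspace ?I" by (simp add: ideal_gen_def)
  have "gens \<subseteq> ?G" by (fastforce simp: gens_def z_def)
  then have "J \<subseteq> radical ?I"
    unfolding ideal_gen_def[of gens] using F(2)
    by (intro ideal.span_minimal subspace_radical[OF I]) auto
  moreover have "radical ?I \<subseteq> radical J"
  proof -
    have "?G \<subseteq> J"
    proof
      fix x assume "x \<in> ?G"
      then consider "x \<in> gens" | "x = 0" by (auto simp: gens_def z_def split: if_splits)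
      then show "x \<in> J" using gens_subset_J ideal.subspace_0[OF ideal_J] by cases auto
    qed
    then have "ideal_gen ?G \<subseteq> J"
      unfolding ideal_gen_def[of ?G] by (rule ideal.span_minimal[OF _ ideal_J])
    then have "?I \<subseteq> J"
      unfolding ideal_gen_def[of "F ` _"] using F(1) by (intro ideal.span_minimal[OF _ ideal_J]) auto
    then show ?thesis by (auto simp: radical_def)
  qed
  ultimately show ?thesis using radical_J[OF assms] by blast
qed

theorem ara_and_codim:
  assumes inf: "infinite (UNIV :: 'k::field set)"
  shows "ara (J :: ('v, 'k) mpol set) = enat (t + 1)"
    and "variety_codim (variety (J :: ('v, 'k) mpol set)) = enat (t + 1)"
proof -
  let ?R = "{r. \<exists>F. (J :: ('v, 'k) mpol set) = radical (ideal_gen (F ` {1..r}))}"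
  show "ara (J :: ('v, 'k) mpol set) = enat (t + 1)"
    unfolding ara_def
  proof (rule antisym)
    show "(INF r\<in>?R. enat r) \<le> enat (t + 1)"
      using ara_upper[OF inf] by (intro INF_lower) blast
    show "enat (t + 1) \<le> (INF r\<in>?R. enat r)"
      using ara_lower by (intro INF_greatest) (simp, blast)
  qed
  have "t + 1 \<le> card (UNIV :: 'v set)" using independent_card[of "{}"] by simp
  then show "variety_codim (variety (J :: ('v, 'k) mpol set)) = enat (t + 1)"
    unfolding variety_codim_def antisym[OF dim_le dim_ge[OF inf]] by simp
qed

end

section \<open>The arithmetical rank of the ideals of two-row matrices\<close>

definition top_entry :: "(entry \<Rightarrow> 'v) \<Rightarrow> nat \<Rightarrow> 'v" where
  "top_entry e i = e (if i < 2 then Ent_x (Suc i) else Ent_y (i - 2))"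

lemma admissible_staircase:
  fixes e :: "entry \<Rightarrow> 'v"
  assumes "1 \<le> t" and adm: "admissible 2 t e"
  shows "staircase (top_entry e) (\<lambda>j. e (Ent_z j)) (e (Ent_x 3)) (e (Ent_x 4)) t"
proof -
  have x: "Ent_x i \<in> entries 2 t" if "i \<in> {1..4}" for i
    using that by (auto simp: entries_def)
  have top: "(if i < 2 then Ent_x (Suc i) else Ent_y (i - 2)) \<in> entries 2 t" if "i \<le> t" for i
    using that by (auto simp: entries_def)
  have z: "Ent_z j \<in> entries 2 t" if "1 \<le> j" "j \<le> t" for j
    using that by (auto simp: entries_def)
  have eq: "p = q \<or> may_coincide 2 t p q \<or> may_coincide 2 t q p"
    if "e p = e q" "p \<in> entries 2 t" "q \<in> entries 2 t" for p q
    using adm that by (auto simp: admissible_def)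
  show ?thesis
  proof
    have "finite (e ` entries 2 t)" by (simp add: entries_def)
    then show "finite (UNIV :: 'v set)" using adm by (simp add: admissible_def)
    show "inj_on (top_entry e) {..t}"
    proof (rule inj_onI)
      fix i j assume "i \<in> {..t}" "j \<in> {..t}" "top_entry e i = top_entry e j"
      then show "i = j"
        using eq[OF _ top top, of i j] by (auto simp: top_entry_def may_coincide_def split: if_splits)
    qed
    show "inj_on (\<lambda>j. e (Ent_z j)) {1..t}"
    proof (rule inj_onI)
      fix i j assume "i \<in> {1..t}" "j \<in> {1..t}" "e (Ent_z i) = e (Ent_z j)"
      then show "i = j"
        using eq[OF _ z z, of i j] by (auto simp: may_coincide_def)
    qed
    show "top_entry e i \<noteq> e (Ent_z j)" if "i \<le> j" "1 \<le> j" "j \<le> t" for i j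
      using eq[OF _ top z, of i j] that by (auto simp: top_entry_def may_coincide_def split: if_splits)
    show "distinct [top_entry e 0, top_entry e 1, e (Ent_x 3), e (Ent_x 4)]"
    proof -
      have "e (Ent_x i) \<noteq> e (Ent_x j)" if "i \<in> {1..4}" "j \<in> {1..4}" "i \<noteq> j" for i j
        using eq[OF _ x x, of i j] that by (auto simp: may_coincide_def)
      then show ?thesis by (simp add: top_entry_def)
    qed
    show "{e (Ent_x 3), e (Ent_x 4)} \<inter> (\<lambda>j. e (Ent_z j)) ` {1..t} = {}"
    proof -
      have "e (Ent_x i) \<noteq> e (Ent_z j)" if "i \<in> {3, 4}" "1 \<le> j" "j \<le> t" for i j
        using eq[OF _ x z, of i j] that by (auto simp: may_coincide_def)
      then show ?thesis by auto
    qed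
  qed (fact \<open>1 \<le> t\<close>)
qed

lemma J_ideal_staircase:
  assumes "1 \<le> t" "admissible 2 t e"
  shows "J_ideal e 2 t
    = ideal_gen (staircase.gens (top_entry e) (\<lambda>j. e (Ent_z j)) (e (Ent_x 3)) (e (Ent_x 4)) t)"
proof -
  interpret staircase "top_entry e" "\<lambda>j. e (Ent_z j)" "e (Ent_x 3)" "e (Ent_x 4)" t
    using assms by (rule admissible_staircase)
  have "1 \<le> i \<and> i < j \<and> j \<le> (2::nat) \<longleftrightarrow> i = 1 \<and> j = 2" for i j by auto
  then have minor: "minor_gens e 2 = {minor}"
    unfolding minor_gens_def minor_def mat_entry_def top_entry_def by (simp add: eval_nat_numeral)
  have uz: "{var (top_entry e i) * var (e (Ent_z j)) | i j. i \<le> j \<and> 1 \<le> j \<and> j \<le> t}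
      = xz_gens e 2 t \<union> yz_gens e t" (is "?L = ?R")
  proof
    show "?L \<subseteq> ?R"
    proof
      fix f assume "f \<in> ?L"
      then obtain i j where f: "f = var (top_entry e i) * var (e (Ent_z j))"
        and ij: "i \<le> j" "1 \<le> j" "j \<le> t" by blast
      show "f \<in> ?R"
      proof (cases "i < 2")
        case True
        then have "f \<in> xz_gens e 2 t"
          unfolding f xz_gens_def top_entry_def using ij True by (intro CollectI exI[of _ "Suc i"] exI[of _ j]) auto
        then show ?thesis ..
      next
        case False
        then have "f \<in> yz_gens e t"
          unfolding f yz_gens_def top_entry_def using ij False by (intro CollectI exI[of _ "i - 2"] exI[of _ j]) auto
        then show ?thesis ..
      qed
    qed
    show "?R \<subseteq> ?L"
    proof
      fix f assume "f \<in> ?R"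
      then show "f \<in> ?L"
      proof
        assume "f \<in> xz_gens e 2 t"
        then obtain i j where "f = var (e (Ent_x i)) * var (e (Ent_z j))" "1 \<le> i" "i \<le> 2" "1 \<le> j" "j \<le> t"
          by (auto simp: xz_gens_def)
        then show ?thesis
          by (intro CollectI exI[of _ "i - 1"] exI[of _ j]) (auto simp: top_entry_def)
      next
        assume "f \<in> yz_gens e t"
        then obtain i j where "f = var (e (Ent_y i)) * var (e (Ent_z j))" "i + 2 \<le> j" "j \<le> t"
          by (auto simp: yz_gens_def)
        then show ?thesis
          by (intro CollectI exI[of _ "i + 2"] exI[of _ j]) (auto simp: top_entry_def)
      qed
    qed
  qed
  show ?thesis
    unfolding J_ideal_def gens_def minor uz Un_assoc by simp
qed

theorem theorem1:
  fixes t :: nat and e :: "entry \<Rightarrow> 'v"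
    and J :: "('v, 'k::alg_closed_field) mpol set"
  assumes "t \<ge> 1"
    and "admissible 2 t e"
    and "J = J_ideal e 2 t"
  shows "ara J = enat (t + 1) \<and> set_theoretic_complete_intersection J"
proof -
  interpret staircase "top_entry e" "\<lambda>j. e (Ent_z j)" "e (Ent_x 3)" "e (Ent_x 4)" t
    using assms(1,2) by (rule admissible_staircase)
  show ?thesis
    unfolding set_theoretic_complete_intersection_def assms(3) J_ideal_staircase[OF assms(1,2)]
    by (simp add: ara_and_codim[OF infinite_alg_closed])
qed

end
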